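(* Let $d\ge1$ be an integer, and consider $d+1$ bodies with positive masses $m_1,\dots,m_{d+1}$ in $\mathbb{R}^d$ moving under Newton's equations with either the Newtonian potential or a potential of general two-body type (both defined in the context). Then there is a function $g=g(q,\dot q)$, defined on the pairs $(q,\dot q)$ of zero angular momentum with $q$ collision-free and $S$ smooth near $q$, with $g>0$ everywhere, such that the following holds. If $q(t)$ is a zero angular momentum solution of Newton's equations and the signed distance $S$ is smooth along $q(t)$, i.e. in a neighborhood of each point $q(t)$, then $S(t):=S(q(t))$ satisfies $$\ddot S=-S\,g(q,\dot q).$$ If, moreover, there is $c>0$ such that all interparticle distances along the solution satisfy $r_{ab}\le c$, then along the solution $g\ge GM/c^3$ in the case of the Newtonian potential, and $g\ge GM\delta$ in the case of a potential of general two-body type, where $\delta=\min_{a\ne b}f_{ab}'(c)/c$.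
   Context: A configuration is $q=(q_1,\dots,q_{d+1})\in(\mathbb{R}^d)^{d+1}$; $r_{ab}=|q_a-q_b|$; $G>0$ is a constant; $M=\sum_am_a$. A configuration is collision-free if all $r_{ab}>0$ for $a\neq b$; solutions are assumed collision-free. Newton's equations are $m_a\ddot q_a=-\partial V/\partial q_a$. The Newtonian potential is $V=-G\sum_{a<b}m_am_b/r_{ab}$. A potential of general two-body type is $V=G\sum_{a<b}m_am_bf_{ab}(r_{ab})$ where the twice continuously differentiable functions $f_{ab}:(0,\infty)\to\mathbb{R}$ satisfy $f_{ab}'(r)>0$ and $f_{ab}''(r)<0$ for $r>0$ and $\lim_{r\to\infty}f_{ab}'(r)/r=0$. Angular momentum is taken in the center-of-mass frame: with $q_{cm}=\frac1M\sum_am_aq_a$ and $\dot q_{cm}=\frac1M\sum_am_a\dot q_a$, zero angular momentum means $\sum_am_a(q_a-q_{cm})\wedge(\dot q_a-\dot q_{cm})=0$. The degeneration locus $\Sigma$ is the set of configurations whose $d+1$ points all lie on a single affine hyperplane of $\mathbb{R}^d$. The mass inner product on configuration space is given by $\langle v,v\rangle=\sum_am_a|v_a|^2$, and $\mathrm{dist}(q,\Sigma)$ denotes the distance from $q$ to $\Sigma$ in the associated norm. The signed distance is $S(q)=\varepsilon(q)\,\mathrm{dist}(q,\Sigma)$, where $\varepsilon(q)$ is the sign of the signed volume, i.e. of $\det(q_2-q_1,\,q_3-q_1,\dots,q_{d+1}-q_1)$; thus $S(q)=0$ if and only if $q\in\Sigma$. *)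

theory Defs
  imports "HOL-Analysis.Analysis"
begin

text \<open>
  The space is \<^typ>\<open>real^'d\<close> with \<open>d = CARD('d)\<close>, and the \<open>d + 1\<close> bodies are indexed by
  \<^typ>\<open>'d option\<close>: \<^term>\<open>None\<close> is the first body and the bodies \<^term>\<open>Some i\<close> are the others.
  Any enumeration of \<^typ>\<open>'d\<close> orders both the coordinates and the bodies \<open>2, \<dots>, d + 1\<close>, so
  determinants of the difference vectors do not depend on it.
\<close>

type_synonym 'd configuration = "(real^'d)^('d option)"

text \<open>
  \<open>C_k_on k f U\<close> is meant for open \<open>U\<close>. Continuity of the iterated directional derivatives is
  equivalent, in finite dimension, to continuity of the iterated Frechet derivatives.
\<close>

primrec C_k_on :: "nat \<Rightarrow> ('a::real_normed_vector \<Rightarrow> real) \<Rightarrow> 'a set \<Rightarrow> bool" where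
  "C_k_on 0 f U \<longleftrightarrow> continuous_on U f"
| "C_k_on (Suc k) f U \<longleftrightarrow>
    (\<exists>f'. (\<forall>x\<in>U. (f has_derivative f' x) (at x)) \<and> (\<forall>v. C_k_on k (\<lambda>x. f' x v) U))"

definition smooth_near :: "('a::real_normed_vector \<Rightarrow> real) \<Rightarrow> 'a \<Rightarrow> bool" where
  "smooth_near f x \<longleftrightarrow> (\<exists>U. open U \<and> x \<in> U \<and> (\<forall>k. C_k_on k f U))"

definition degeneration_locus :: "'d::finite configuration set" where
  "degeneration_locus = {q. \<exists>n b. n \<noteq> 0 \<and> (\<forall>a. q $ a \<in> {x. n \<bullet> x = b})}"

definition mass_norm :: "('d option \<Rightarrow> real) \<Rightarrow> 'd::finite configuration \<Rightarrow> real" where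
  "mass_norm m v = sqrt (\<Sum>a\<in>UNIV. m a * (norm (v $ a))\<^sup>2)"

definition mass_dist_locus :: "('d option \<Rightarrow> real) \<Rightarrow> 'd::finite configuration \<Rightarrow> real" where
  "mass_dist_locus m q = (INF p\<in>degeneration_locus. mass_norm m (q - p))"

definition signed_volume :: "'d::finite configuration \<Rightarrow> real" where
  "signed_volume q = det (\<chi> i j. (q $ Some j - q $ None) $ i)"

definition signed_distance :: "('d option \<Rightarrow> real) \<Rightarrow> 'd::finite configuration \<Rightarrow> real" where
  "signed_distance m q = sgn (signed_volume q) * mass_dist_locus m q"

definition total_mass :: "('d::finite option \<Rightarrow> real) \<Rightarrow> real" where
  "total_mass m = (\<Sum>a\<in>UNIV. m a)"

definition mass_center :: "('d option \<Rightarrow> real) \<Rightarrow> 'd::finite configuration \<Rightarrow> real^'d" where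
  "mass_center m q = (1 / total_mass m) *\<^sub>R (\<Sum>a\<in>UNIV. m a *\<^sub>R q $ a)"

text \<open>Bivectors are represented by antisymmetric matrices.\<close>

definition wedge :: "real^'d \<Rightarrow> real^'d \<Rightarrow> real^'d^'d::finite" where
  "wedge x y = (\<chi> i j. x $ i * y $ j - x $ j * y $ i)"

definition angular_momentum ::
    "('d option \<Rightarrow> real) \<Rightarrow> 'd::finite configuration \<Rightarrow> 'd configuration \<Rightarrow> real^'d^'d" where
  "angular_momentum m q v =
    (\<Sum>a\<in>UNIV. m a *\<^sub>R wedge (q $ a - mass_center m q) (v $ a - mass_center m v))"

definition collision_free :: "'d::finite configuration \<Rightarrow> bool" where
  "collision_free q \<longleftrightarrow> (\<forall>a b. a \<noteq> b \<longrightarrow> dist (q $ a) (q $ b) > 0)"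

text \<open>
  Sums over unordered pairs of bodies are half of the sums over ordered pairs of distinct bodies;
  for \<open>two_body_potential\<close> this uses the symmetry of the family \<open>f\<close>, which is
  part of \<open>admissible_family\<close>.
\<close>

definition newtonian_potential ::
    "real \<Rightarrow> ('d option \<Rightarrow> real) \<Rightarrow> 'd::finite configuration \<Rightarrow> real" where
  "newtonian_potential G m q =
    - G * ((\<Sum>(a, b) | a \<noteq> b. m a * m b / dist (q $ a) (q $ b)) / 2)"

definition two_body_potential ::
    "real \<Rightarrow> ('d option \<Rightarrow> real) \<Rightarrow> ('d option \<Rightarrow> 'd option \<Rightarrow> real \<Rightarrow> real)
      \<Rightarrow> 'd::finite configuration \<Rightarrow> real" where
  "two_body_potential G m f q =
    G * ((\<Sum>(a, b) | a \<noteq> b. m a * m b * f a b (dist (q $ a) (q $ b))) / 2)"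

definition admissible_profile :: "(real \<Rightarrow> real) \<Rightarrow> bool" where
  "admissible_profile h \<longleftrightarrow>
    (\<forall>r>0. h field_differentiable at r \<and> deriv h field_differentiable at r) \<and>
    continuous_on {0<..} (deriv (deriv h)) \<and>
    (\<forall>r>0. deriv h r > 0 \<and> deriv (deriv h) r < 0) \<and>
    ((\<lambda>r. deriv h r / r) \<longlongrightarrow> 0) at_top"

definition admissible_family :: "('d option \<Rightarrow> 'd option \<Rightarrow> real \<Rightarrow> real) \<Rightarrow> bool" where
  "admissible_family f \<longleftrightarrow>
    (\<forall>a b. a \<noteq> b \<longrightarrow> admissible_profile (f a b) \<and> (\<forall>r>0. f a b r = f b a r))"

text \<open>
  The argument \<open>v\<close> is the velocity of \<open>q\<close>. The function differentiated by \<open>GDERIV\<close> is \<open>V\<close>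
  as a function of the position of body \<open>a\<close> alone.
\<close>

definition newton_solution ::
    "('d option \<Rightarrow> real) \<Rightarrow> ('d::finite configuration \<Rightarrow> real) \<Rightarrow> real set
      \<Rightarrow> (real \<Rightarrow> 'd configuration) \<Rightarrow> (real \<Rightarrow> 'd configuration) \<Rightarrow> bool" where
  "newton_solution m V I q v \<longleftrightarrow>
    open I \<and> is_interval I \<and>
    (\<exists>acc. \<forall>t\<in>I.
      collision_free (q t) \<and>
      (q has_vector_derivative v t) (at t) \<and>
      (v has_vector_derivative acc t) (at t) \<and>
      (\<forall>a. GDERIV (\<lambda>x. V (\<chi> b. if b = a then x else q t $ b)) (q t $ a)
              :> - (m a *\<^sub>R acc t $ a)))"

end

theory Submission
  imports Defs
begin

text \<open>
  Let \<open>x_a\<close> be the position of body \<open>a\<close> relative to the center of mass. Projecting all bodies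
  orthogonally to a hyperplane with unit normal \<open>n\<close> through the center of mass is the cheapest way
  to flatten the configuration in the direction \<open>n\<close>, and it costs the moment
  \<open>\<Sum>a. m a * (n \<bullet> x_a)\<^sup>2\<close> in squared mass distance. Hence \<open>S\<^sup>2\<close> is the minimum of this moment over
  unit vectors, the smallest eigenvalue of the inertia matrix (\<open>S_le_moment\<close>, \<open>closest_normal\<close>).
  Every property of \<open>S\<close> below comes from evaluating the moment at a well chosen normal, possibly
  moving with time: this bounds \<open>S\<^sup>2\<close> from above, with equality at the given configuration, and
  comparing the first and second derivatives of the two sides gives information on \<open>S\<close>.

  Along a motion with velocity \<open>v\<close> and acceleration \<open>acc\<close>, the second time derivative of \<open>S\<close> is
  \<open>D\<^sup>2S(v, v) + DS(acc)\<close>.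

  Off the degeneration locus neither term has the sign of \<open>S\<close>. First,
  \<open>S * DS(w) = \<Sum>a. m a * (n \<bullet> x_a) * (n \<bullet> w_a)\<close> for a minimizing \<open>n\<close> (\<open>S_times_derivative\<close>), so
  Newton's equations turn \<open>S * DS(acc)\<close> into minus half of
  \<open>G * \<Sum>m a * m b * (f_ab'(r) / r) * (n \<bullet> (q_a - q_b))\<^sup>2\<close>, and since
  the pairwise sum of \<open>m a * m b * (n \<bullet> (q_a - q_b))\<^sup>2\<close> is a multiple of the moment, this is at
  most \<open>- G * M * K * S\<^sup>2\<close>, where \<open>K\<close> is the least stiffness \<open>f_ab'(r_ab) / r_ab\<close>. Second,
  \<open>S * D\<^sup>2S(v, v) \<le> 0\<close> when the angular momentum vanishes (\<open>S_second_derivative_sign\<close>): the bodies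
  are in general position, so the velocities are \<open>L x_a\<close> for one linear map \<open>L\<close>, vanishing angular
  momentum says that the adjoint of \<open>L\<close> is symmetric for the inertia form, and the bound comes from
  the moving normal of the hyperplanes that the maps \<open>1 + t L\<close> carry along.

  On the locus both terms vanish. The force is tangent to the hyperplane of the bodies, along
  which \<open>S\<close> stays zero. For the inertial term, \<open>\<bar>S(q + t v)\<bar>\<close> is at most \<open>\<bar>t\<bar>\<close> times
  the mass norm of the normal velocity, while \<open>\<bar>DS(v)\<bar>\<close> equals that mass norm; an odd linear bound
  attained to first order from both sides leaves no room for a second-order term
  (\<open>S_second_derivative_on_locus\<close>). The equality needs the bodies to span a
  hyperplane; if they did not, then \<open>DS\<close> would vanish, but the gradient of a smooth
  distance has mass norm one (\<open>gradient_nonzero\<close>).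

  So \<open>g = - (D\<^sup>2S(v, v) + DS(acc)) / S\<close> off the locus and \<open>g = G * M * K\<close> on it satisfy the
  oscillator equation with \<open>g \<ge> G * M * K\<close>; since \<open>f'(r) / r\<close> decreases, \<open>r_ab \<le> c\<close> forces
  \<open>K \<ge> min f_ab'(c) / c\<close>. The Newtonian potential is the case \<open>f_ab(r) = - 1 / r\<close>.
\<close>

section \<open>Directional derivatives along curves\<close>

definition dir_deriv :: "('a::real_normed_vector \<Rightarrow> real) \<Rightarrow> 'a \<Rightarrow> 'a \<Rightarrow> real" where
  "dir_deriv F x w = deriv (\<lambda>t. F (x + t *\<^sub>R w)) 0"

definition dir_deriv2 :: "('a::real_normed_vector \<Rightarrow> real) \<Rightarrow> 'a \<Rightarrow> 'a \<Rightarrow> real" where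
  "dir_deriv2 F x w = dir_deriv (\<lambda>y. dir_deriv F y w) x w"

lemma has_derivative_along_line:
  assumes "(F has_derivative F') (at x)"
  shows "((\<lambda>t. F (x + t *\<^sub>R w)) has_real_derivative F' w) (at 0)"
proof -
  have "((\<lambda>t. F (x + t *\<^sub>R w)) has_derivative (\<lambda>t. F' (t *\<^sub>R w))) (at 0)"
    by (rule has_derivative_compose[of "\<lambda>t. x + t *\<^sub>R w" "\<lambda>t. t *\<^sub>R w" 0 UNIV F F'])
       (auto intro!: derivative_eq_intros simp: assms)
  moreover have "F' (t *\<^sub>R w) = F' w * t" for t
    using linear_scale[OF has_derivative_linear[OF assms]] by simp
  ultimately show ?thesis by (simp add: has_field_derivative_def)
qed

lemma dir_deriv_eq:
  assumes "(F has_derivative F') (at x)"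
  shows "dir_deriv F x w = F' w"
  unfolding dir_deriv_def by (rule DERIV_imp_deriv) (rule has_derivative_along_line[OF assms])

text \<open>
  The representatives of the derivatives that \<^const>\<open>smooth_near\<close> provides are only determined on
  some neighborhood; \<open>dir_deriv\<close> names them uniformly, so that derivatives at different points of a
  curve can be compared.
\<close>
lemma smooth_near_C2:
  assumes "smooth_near F q"
  obtains U where "open U" "q \<in> U"
    "\<And>x. x \<in> U \<Longrightarrow> (F has_derivative dir_deriv F x) (at x)"
    "\<And>x w. x \<in> U \<Longrightarrow>
       ((\<lambda>y. dir_deriv F y w) has_derivative dir_deriv (\<lambda>y. dir_deriv F y w) x) (at x)"
proof -
  obtain U where U: "open U" "q \<in> U" "\<And>k. C_k_on k F U"
    using assms unfolding smooth_near_def by blast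
  obtain F' where F': "\<And>x. x \<in> U \<Longrightarrow> (F has_derivative F' x) (at x)"
      "\<And>w. C_k_on (Suc 0) (\<lambda>x. F' x w) U"
    using U(3)[of "Suc (Suc 0)"] unfolding C_k_on.simps(2)[of "Suc 0" F] by blast
  have eq: "dir_deriv F x = F' x" if "x \<in> U" for x
    using dir_deriv_eq[OF F'(1)[OF that]] by blast
  show ?thesis
  proof (rule that[OF U(1,2)])
    fix x assume x: "x \<in> U"
    show "(F has_derivative dir_deriv F x) (at x)" using F'(1)[OF x] eq[OF x] by simp
    fix w
    obtain F'' where "((\<lambda>y. F' y w) has_derivative F'') (at x)"
      using F'(2)[of w] x by auto
    then have "((\<lambda>y. dir_deriv F y w) has_derivative F'') (at x)"
      by (rule has_derivative_transform_within_open[OF _ U(1) x]) (simp add: eq)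
    then show "((\<lambda>y. dir_deriv F y w) has_derivative dir_deriv (\<lambda>y. dir_deriv F y w) x) (at x)"
      using dir_deriv_eq by (metis (no_types, lifting) ext)
  qed
qed

lemma smooth_near_has_derivative:
  "smooth_near F q \<Longrightarrow> (F has_derivative dir_deriv F q) (at q)"
  by (erule smooth_near_C2) blast

text \<open>
  The second statement is the chain rule for \<open>DF(q)(v)\<close> in both arguments. As smoothness is phrased
  with directional derivatives for fixed directions, \<open>v\<close> is first expanded in the standard basis.
\<close>
lemma smooth_near_along_curve:
  fixes F :: "'a::euclidean_space \<Rightarrow> real"
  assumes smooth: "smooth_near F (q t)"
    and q: "\<forall>\<^sub>F s in nhds t. (q has_vector_derivative v s) (at s)"
    and v: "(v has_vector_derivative a) (at t)"
  shows "\<forall>\<^sub>F s in nhds t. ((\<lambda>s. F (q s)) has_real_derivative dir_deriv F (q s) (v s)) (at s)"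
    and "((\<lambda>s. dir_deriv F (q s) (v s)) has_real_derivative
           dir_deriv2 F (q t) (v t) + dir_deriv F (q t) a) (at t)"
proof -
  obtain U where U: "open U" "q t \<in> U"
    "\<And>x. x \<in> U \<Longrightarrow> (F has_derivative dir_deriv F x) (at x)"
    "\<And>x w. x \<in> U \<Longrightarrow>
       ((\<lambda>y. dir_deriv F y w) has_derivative dir_deriv (\<lambda>y. dir_deriv F y w) x) (at x)"
    using smooth_near_C2[OF smooth] by blast
  have qt: "(q has_vector_derivative v t) (at t)" using q by (rule eventually_nhds_x_imp_x)
  have "isCont q t" using qt by (rule has_vector_derivative_continuous)
  then have inU: "\<forall>\<^sub>F s in nhds t. q s \<in> U"
    using U(1,2) topological_tendstoD by (fastforce simp: isCont_def tendsto_at_iff_tendsto_nhds)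
  have lin: "linear (dir_deriv F x)" if "x \<in> U" for x
    using U(3)[OF that] by (rule has_derivative_linear)
  have chain: "((\<lambda>s. H (q s)) has_real_derivative H' (v s)) (at s)"
    if H: "(H has_derivative H') (at (q s))" and qs: "(q has_vector_derivative v s) (at s)" for H H' s
  proof -
    have "((\<lambda>s. H (q s)) has_derivative (\<lambda>h. H' (h *\<^sub>R v s))) (at s)"
      using has_derivative_compose[OF qs[unfolded has_vector_derivative_def] H] .
    moreover have "H' (h *\<^sub>R v s) = H' (v s) * h" for h
      using linear_scale[OF has_derivative_linear[OF H]] by simp
    ultimately show ?thesis by (simp add: has_field_derivative_def)
  qed
  show "\<forall>\<^sub>F s in nhds t. ((\<lambda>s. F (q s)) has_real_derivative dir_deriv F (q s) (v s)) (at s)"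
    using inU q by eventually_elim (rule chain[OF U(3)])
  have expand: "dir_deriv F x w = (\<Sum>b\<in>Basis. (w \<bullet> b) * dir_deriv F x b)" if "x \<in> U" for x w
  proof -
    have "dir_deriv F x w = dir_deriv F x (\<Sum>b\<in>Basis. (w \<bullet> b) *\<^sub>R b)"
      by (simp add: euclidean_representation)
    also have "\<dots> = (\<Sum>b\<in>Basis. (w \<bullet> b) * dir_deriv F x b)"
      by (simp add: linear_sum[OF lin[OF that]] linear_scale[OF lin[OF that]])
    finally show ?thesis .
  qed
  have expand2: "dir_deriv2 F (q t) (v t) =
      (\<Sum>b\<in>Basis. (v t \<bullet> b) * dir_deriv (\<lambda>y. dir_deriv F y b) (q t) (v t))"
  proof -
    have "((\<lambda>y. \<Sum>b\<in>Basis. (v t \<bullet> b) * dir_deriv F y b) has_derivative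
        (\<lambda>w. \<Sum>b\<in>Basis. (v t \<bullet> b) * dir_deriv (\<lambda>y. dir_deriv F y b) (q t) w)) (at (q t))"
      by (intro has_derivative_sum has_derivative_mult_right U(4) U(2))
    then have "((\<lambda>y. dir_deriv F y (v t)) has_derivative
        (\<lambda>w. \<Sum>b\<in>Basis. (v t \<bullet> b) * dir_deriv (\<lambda>y. dir_deriv F y b) (q t) w)) (at (q t))"
      by (rule has_derivative_transform_within_open[OF _ U(1,2)]) (simp add: expand[symmetric])
    then show ?thesis unfolding dir_deriv2_def by (rule dir_deriv_eq)
  qed
  have coord: "((\<lambda>s. v s \<bullet> b) has_real_derivative a \<bullet> b) (at t)" for b
    using v unfolding has_vector_derivative_def has_field_derivative_def
    by (auto intro!: derivative_eq_intros simp: mult.commute)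
  have "((\<lambda>s. \<Sum>b\<in>Basis. (v s \<bullet> b) * dir_deriv F (q s) b) has_real_derivative
     (\<Sum>b\<in>Basis. (a \<bullet> b) * dir_deriv F (q t) b +
        dir_deriv (\<lambda>y. dir_deriv F y b) (q t) (v t) * (v t \<bullet> b))) (at t)"
    by (intro DERIV_sum DERIV_mult coord chain U(4) U(2) qt)
  then have "((\<lambda>s. \<Sum>b\<in>Basis. (v s \<bullet> b) * dir_deriv F (q s) b) has_real_derivative
     dir_deriv2 F (q t) (v t) + dir_deriv F (q t) a) (at t)"
    unfolding expand2 expand[OF U(2), of a] by (simp add: sum.distrib mult.commute add.commute)
  moreover have "\<forall>\<^sub>F s in nhds t. dir_deriv F (q s) (v s) = (\<Sum>b\<in>Basis. (v s \<bullet> b) * dir_deriv F (q s) b)"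
    using inU by eventually_elim (rule expand)
  ultimately show "((\<lambda>s. dir_deriv F (q s) (v s)) has_real_derivative
           dir_deriv2 F (q t) (v t) + dir_deriv F (q t) a) (at t)"
    by (subst DERIV_cong_ev[OF refl _ refl])
qed

lemma smooth_near_along_line:
  fixes F :: "'a::euclidean_space \<Rightarrow> real"
  assumes "smooth_near F q"
  shows "\<forall>\<^sub>F s in nhds 0. ((\<lambda>s. F (q + s *\<^sub>R v)) has_real_derivative
           dir_deriv F (q + s *\<^sub>R v) v) (at s)"
    and "((\<lambda>s. dir_deriv F (q + s *\<^sub>R v) v) has_real_derivative dir_deriv2 F q v) (at 0)"
proof -
  have line: "((\<lambda>s. q + s *\<^sub>R v) has_vector_derivative v) (at s)" for s
    by (auto intro!: derivative_eq_intros)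
  have F: "smooth_near F (q + 0 *\<^sub>R v)" using assms by simp
  note curve = smooth_near_along_curve[where q = "\<lambda>s. q + s *\<^sub>R v" and v = "\<lambda>_. v" and t = 0 and a = 0,
    OF F always_eventually[OF allI[OF line]] has_vector_derivative_const]
  show "\<forall>\<^sub>F s in nhds 0. ((\<lambda>s. F (q + s *\<^sub>R v)) has_real_derivative
           dir_deriv F (q + s *\<^sub>R v) v) (at s)"
    by (rule curve(1))
  show "((\<lambda>s. dir_deriv F (q + s *\<^sub>R v) v) has_real_derivative dir_deriv2 F q v) (at 0)"
    using curve(2) linear_0[OF has_derivative_linear[OF smooth_near_has_derivative[OF assms]]]
    by simp
qed

text \<open>
  Applied to the difference of the two sides of an estimate that is sharp at \<open>0\<close>. The conclusion
  holds on both sides of \<open>0\<close>, so an inequality known on one side only already decides the sign of the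
  second derivative.
\<close>
lemma negative_of_second_derivative_negative:
  fixes \<phi> \<phi>' :: "real \<Rightarrow> real"
  assumes D: "\<forall>\<^sub>F t in nhds 0. (\<phi> has_real_derivative \<phi>' t) (at t)"
    and D2: "(\<phi>' has_real_derivative c) (at 0)"
    and "\<phi> 0 = 0" "\<phi>' 0 = 0" "c < 0"
  shows "\<exists>e>0. \<forall>t. 0 < \<bar>t\<bar> \<and> \<bar>t\<bar> < e \<longrightarrow> \<phi> t < 0"
proof -
  obtain e1 where e1: "e1 > 0" "\<And>t. \<bar>t\<bar> < e1 \<Longrightarrow> (\<phi> has_real_derivative \<phi>' t) (at t)"
    using D unfolding eventually_nhds_metric by (auto simp: dist_real_def)
  obtain e2 where e2: "e2 > 0" "\<And>h. 0 < h \<Longrightarrow> h < e2 \<Longrightarrow> \<phi>' h < 0"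
    using DERIV_neg_dec_right[OF D2 \<open>c < 0\<close>] assms(4) by auto
  obtain e3 where e3: "e3 > 0" "\<And>h. 0 < h \<Longrightarrow> h < e3 \<Longrightarrow> \<phi>' (- h) > 0"
    using DERIV_neg_dec_left[OF D2 \<open>c < 0\<close>] assms(4) by auto
  define e where "e = min e1 (min e2 e3)"
  have "\<phi> t < 0" if t: "0 < \<bar>t\<bar>" "\<bar>t\<bar> < e" for t
  proof (cases "t > 0")
    case True
    obtain z where "0 < z" "z < t" "\<phi> t - \<phi> 0 = (t - 0) * \<phi>' z"
      using MVT2[of 0 t \<phi> \<phi>'] True t e1(2) by (auto simp: e_def)
    then show ?thesis using e2(2)[of z] t True assms(3) by (simp add: e_def mult_pos_neg)
  next
    case False
    then have "t < 0" using t by simp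
    obtain z where "t < z" "z < 0" "\<phi> 0 - \<phi> t = (0 - t) * \<phi>' z"
      using MVT2[of t 0 \<phi> \<phi>'] \<open>t < 0\<close> t e1(2) by (auto simp: e_def)
    then show ?thesis using e3(2)[of "- z"] t \<open>t < 0\<close> assms(3)
      by (simp add: e_def) (smt (verit) mult_neg_pos)
  qed
  then show ?thesis using e1(1) e2(1) e3(1) by (intro exI[of _ e]) (auto simp: e_def)
qed

section \<open>The signed distance as a minimal moment\<close>

locale masses =
  fixes m :: "'d::finite option \<Rightarrow> real"
  assumes mass_pos: "m a > 0"
begin

abbreviation S :: "'d configuration \<Rightarrow> real" where
  "S \<equiv> signed_distance m"

definition centered :: "'d configuration \<Rightarrow> 'd option \<Rightarrow> real^'d" where
  "centered q a = q $ a - mass_center m q"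

text \<open>
  The quadratic form of the inertia matrix. For a unit vector \<open>n\<close> this is the squared mass distance
  from \<open>q\<close> to the configurations lying in a hyperplane orthogonal to \<open>n\<close>.
\<close>
definition moment :: "'d configuration \<Rightarrow> real^'d \<Rightarrow> real" where
  "moment q n = (\<Sum>a\<in>UNIV. m a * (n \<bullet> centered q a)\<^sup>2)"

lemma total_mass_pos: "total_mass m > 0"
  unfolding total_mass_def by (rule sum_pos) (use mass_pos in auto)

lemma mass_sum_nonneg: "(\<And>a. f a \<ge> 0) \<Longrightarrow> (\<Sum>a\<in>UNIV. m a * f a) \<ge> 0"
  by (intro sum_nonneg mult_nonneg_nonneg less_imp_le[OF mass_pos])

lemma mass_sum_eq_0_iff:
  assumes "\<And>a. f a \<ge> 0"
  shows "(\<Sum>a\<in>UNIV. m a * f a) = 0 \<longleftrightarrow> (\<forall>a. f a = 0)"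
proof -
  have "(\<Sum>a\<in>UNIV. m a * f a) = 0 \<longleftrightarrow> (\<forall>a\<in>UNIV. m a * f a = 0)"
    by (rule sum_nonneg_eq_0_iff) (simp_all add: assms less_imp_le[OF mass_pos])
  then show ?thesis using mass_pos by (auto simp: less_le)
qed

lemma centered_line: "centered (q + t *\<^sub>R v) a = centered q a + t *\<^sub>R centered v a"
  unfolding mass_center_def centered_def
  by (simp add: sum.distrib scaleR_add_right scaleR_sum_right mult.commute mult.left_commute algebra_simps)

lemma sum_mass_inner:
  "(\<Sum>a\<in>UNIV. m a * (n \<bullet> q $ a)) = total_mass m * (n \<bullet> mass_center m q)"
  using total_mass_pos unfolding mass_center_def
  by (simp add: inner_sum_right)

lemma sum_mass_centered: "(\<Sum>a\<in>UNIV. m a * (n \<bullet> centered q a)) = 0"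
  using sum_mass_inner[of n q] unfolding centered_def
  by (simp add: inner_diff_right right_diff_distrib sum_subtractf total_mass_def sum_distrib_right)

text \<open>
  Centering one factor makes centering the other immaterial; this lets formulas found in the
  center-of-mass frame be applied to accelerations and forces.
\<close>
lemma sum_mass_centered_mult:
  "(\<Sum>a\<in>UNIV. m a * (n \<bullet> centered q a) * (u \<bullet> centered w a))
     = (\<Sum>a\<in>UNIV. m a * (n \<bullet> centered q a) * (u \<bullet> w $ a))"
  using sum_mass_centered[of n q]
  by (simp add: centered_def[of w] inner_diff_right[of u] right_diff_distrib[of "_ * _"]
      sum_subtractf sum_distrib_right[symmetric])

lemma parallel_axis:
  "(\<Sum>a\<in>UNIV. m a * (n \<bullet> q $ a - b)\<^sup>2)
     = moment q n + total_mass m * (n \<bullet> mass_center m q - b)\<^sup>2"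
proof -
  define k where "k = n \<bullet> mass_center m q - b"
  have "(\<Sum>a\<in>UNIV. m a * (n \<bullet> q $ a - b)\<^sup>2)
      = (\<Sum>a\<in>UNIV. m a * (n \<bullet> centered q a)\<^sup>2
          + 2 * k * (m a * (n \<bullet> centered q a)) + m a * k\<^sup>2)"
    by (rule sum.cong) (auto simp: k_def centered_def inner_diff_right power2_eq_square algebra_simps)
  also have "\<dots> = moment q n + 2 * k * 0 + total_mass m * k\<^sup>2"
    unfolding sum.distrib sum_distrib_left[symmetric] sum_distrib_right[symmetric]
      sum_mass_centered moment_def total_mass_def ..
  finally show ?thesis by (simp add: k_def)
qed

lemma moment_nonneg: "moment q n \<ge> 0"
  unfolding moment_def by (rule mass_sum_nonneg) simp

lemma moment_zero [simp]: "moment q 0 = 0"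
  by (simp add: moment_def)

lemma moment_scaleR: "moment q (c *\<^sub>R n) = c\<^sup>2 * moment q n"
  unfolding moment_def by (simp add: power_mult_distrib sum_distrib_left mult.left_commute)

lemma continuous_on_moment: "continuous_on A (moment q)"
  unfolding moment_def by (intro continuous_intros)

lemma moment_eq_0_iff: "moment q n = 0 \<longleftrightarrow> (\<forall>a. n \<bullet> centered q a = 0)"
  unfolding moment_def by (simp add: mass_sum_eq_0_iff)

lemma mass_norm_nonneg: "mass_norm m q \<ge> 0"
  unfolding mass_norm_def by (intro real_sqrt_ge_zero mass_sum_nonneg) simp

lemma mass_norm_squared: "(mass_norm m q)\<^sup>2 = (\<Sum>a\<in>UNIV. m a * (norm (q $ a))\<^sup>2)"
  unfolding mass_norm_def by (intro real_sqrt_pow2 mass_sum_nonneg) simp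

lemma degeneration_locus_nonempty: "(degeneration_locus :: 'd configuration set) \<noteq> {}"
proof -
  have "axis undefined 1 \<noteq> (0 :: real^'d)" by (simp add: axis_eq_0_iff)
  then have "0 \<in> (degeneration_locus :: 'd configuration set)"
    unfolding degeneration_locus_def by auto
  then show ?thesis by blast
qed

lemma mass_dist_locus_le:
  "p \<in> degeneration_locus \<Longrightarrow> mass_dist_locus m q \<le> mass_norm m (q - p)"
  unfolding mass_dist_locus_def by (intro cINF_lower bdd_belowI2[of _ 0] mass_norm_nonneg)

lemma mass_dist_locus_nonneg: "mass_dist_locus m q \<ge> 0"
  unfolding mass_dist_locus_def
  by (intro cINF_greatest mass_norm_nonneg degeneration_locus_nonempty)

text \<open>
  The competitor is the orthogonal projection of all bodies to the hyperplane with normal \<open>n\<close>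
  through the center of mass.
\<close>
lemma mass_dist_locus_le_moment: "(mass_dist_locus m q)\<^sup>2 * (n \<bullet> n) \<le> moment q n"
proof (cases "n = 0")
  case False
  define b where "b = n \<bullet> mass_center m q"
  define p where "p = (\<chi> a. q $ a - ((n \<bullet> q $ a - b) / (n \<bullet> n)) *\<^sub>R n)"
  have "\<forall>a. n \<bullet> p $ a = b" using False by (simp add: p_def inner_diff_right)
  then have "p \<in> degeneration_locus" unfolding degeneration_locus_def using False by auto
  then have "(mass_dist_locus m q)\<^sup>2 \<le> (mass_norm m (q - p))\<^sup>2"
    by (intro power_mono mass_dist_locus_le mass_dist_locus_nonneg)
  also have "\<dots> = (\<Sum>a\<in>UNIV. m a * (n \<bullet> q $ a - b)\<^sup>2 / (n \<bullet> n))"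
    unfolding mass_norm_squared
  proof (rule sum.cong)
    fix a
    have "(norm ((q - p) $ a))\<^sup>2 = ((n \<bullet> q $ a - b) / (n \<bullet> n))\<^sup>2 * (n \<bullet> n)"
      unfolding power2_norm_eq_inner p_def by (simp add: power2_eq_square)
    also have "\<dots> = (n \<bullet> q $ a - b)\<^sup>2 / (n \<bullet> n)"
      using False by (simp add: power2_eq_square)
    finally show "m a * (norm ((q - p) $ a))\<^sup>2 = m a * (n \<bullet> q $ a - b)\<^sup>2 / (n \<bullet> n)" by simp
  qed simp
  also have "\<dots> = moment q n / (n \<bullet> n)"
    unfolding sum_divide_distrib[symmetric] parallel_axis by (simp add: b_def)
  finally show ?thesis using False by (simp add: pos_le_divide_eq)
qed simp

text \<open>
  A configuration contained in a hyperplane differs from \<open>q\<close>, body by body, by at least the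
  distance of \<open>q\<close> to that hyperplane, and by \<open>parallel_axis\<close> the best hyperplane with given normal
  passes through the center of mass. So the distance is bounded below by the minimum of the moment
  over the compact unit sphere.
\<close>
lemma moment_attains_mass_dist_locus:
  obtains n where "norm n = 1" "moment q n = (mass_dist_locus m q)\<^sup>2"
proof -
  have "norm (axis undefined 1 :: real^'d) = 1" by (rule norm_axis_1)
  then have "sphere (0::real^'d) 1 \<noteq> {}" by (metis empty_iff mem_sphere_0)
  then obtain n where n: "n \<in> sphere 0 1" "\<And>u. u \<in> sphere 0 1 \<Longrightarrow> moment q n \<le> moment q u"
    using continuous_attains_inf[OF compact_sphere _ continuous_on_moment] by blast
  have scaled: "moment q n * (norm u)\<^sup>2 \<le> moment q u" for u
  proof (cases "u = 0")
    case False
    then have "moment q n \<le> moment q ((1 / norm u) *\<^sub>R u)" by (intro n(2)) auto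
    then show ?thesis using False by (simp add: moment_scaleR power_divide field_simps)
  qed simp
  have "sqrt (moment q n) \<le> mass_dist_locus m q"
    unfolding mass_dist_locus_def
  proof (rule cINF_greatest[OF degeneration_locus_nonempty])
    fix p :: "'d configuration" assume "p \<in> degeneration_locus"
    then obtain u b where u: "u \<noteq> 0" "\<And>a. u \<bullet> p $ a = b" unfolding degeneration_locus_def by auto
    have "moment q n * (norm u)\<^sup>2 \<le> moment q u" by (rule scaled)
    also have "\<dots> \<le> (\<Sum>a\<in>UNIV. m a * (u \<bullet> q $ a - b)\<^sup>2)"
      using total_mass_pos by (simp add: parallel_axis)
    also have "\<dots> \<le> (\<Sum>a\<in>UNIV. m a * ((norm u)\<^sup>2 * (norm ((q - p) $ a))\<^sup>2))"
    proof (intro sum_mono mult_left_mono less_imp_le[OF mass_pos])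
      fix a
      have "(u \<bullet> q $ a - b)\<^sup>2 = (u \<bullet> (q - p) $ a)\<^sup>2" using u(2)[of a] by (simp add: inner_diff_right)
      also have "\<dots> \<le> (u \<bullet> u) * ((q - p) $ a \<bullet> (q - p) $ a)" by (rule Cauchy_Schwarz_ineq)
      finally show "(u \<bullet> q $ a - b)\<^sup>2 \<le> (norm u)\<^sup>2 * (norm ((q - p) $ a))\<^sup>2"
        by (simp add: power2_norm_eq_inner)
    qed
    also have "\<dots> = (mass_norm m (q - p))\<^sup>2 * (norm u)\<^sup>2"
      unfolding mass_norm_squared sum_distrib_right by (intro sum.cong) auto
    finally have "moment q n \<le> (mass_norm m (q - p))\<^sup>2" using u(1) by simp
    then show "sqrt (moment q n) \<le> mass_norm m (q - p)"
      by (rule real_le_lsqrt[OF mass_norm_nonneg])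
  qed
  then have "moment q n \<le> (mass_dist_locus m q)\<^sup>2" by (rule sqrt_le_D)
  moreover have "(mass_dist_locus m q)\<^sup>2 \<le> moment q n"
    using mass_dist_locus_le_moment[of q n] n(1) by (simp add: power2_norm_eq_inner[symmetric])
  ultimately show ?thesis using that[of n] n(1) by simp
qed

lemma signed_volume_eq_0_iff:
  "signed_volume q = 0 \<longleftrightarrow> (\<exists>n. n \<noteq> 0 \<and> moment q n = 0)" for q :: "'d configuration"
proof -
  define Q where "Q = (\<chi> i j. (q $ Some j - q $ None) $ i)"
  have Qn: "(transpose Q *v n) $ j = n \<bullet> (q $ Some j - q $ None)" for n j
    by (simp add: Q_def matrix_vector_mult_def transpose_def inner_vec_def mult.commute)
  have "signed_volume q = det Q" unfolding signed_volume_def Q_def ..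
  then have "signed_volume q = 0 \<longleftrightarrow> \<not> invertible (transpose Q)"
    by (simp add: invertible_det_nz)
  also have "\<dots> \<longleftrightarrow> (\<exists>n. n \<noteq> 0 \<and> transpose Q *v n = 0)"
    unfolding invertible_left_inverse matrix_left_invertible_ker by blast
  also have "\<dots> \<longleftrightarrow> (\<exists>n. n \<noteq> 0 \<and> (\<forall>j. n \<bullet> (q $ Some j - q $ None) = 0))"
    unfolding vec_eq_iff[of "_ *v _"] Qn by simp
  also have "\<dots> \<longleftrightarrow> (\<exists>n. n \<noteq> 0 \<and> (\<forall>a. n \<bullet> (q $ a - q $ None) = 0))"
    by (metis not_None_eq diff_self inner_zero_right)
  also have "\<dots> \<longleftrightarrow> (\<exists>n. n \<noteq> 0 \<and> moment q n = 0)"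
  proof -
    have "(\<forall>a. n \<bullet> (q $ a - q $ None) = 0) \<longleftrightarrow> (\<forall>a. n \<bullet> centered q a = 0)" for n
    proof
      assume "\<forall>a. n \<bullet> (q $ a - q $ None) = 0"
      then have eq: "n \<bullet> q $ a = n \<bullet> q $ None" for a by (simp add: inner_diff_right)
      have "(\<Sum>a\<in>UNIV. m a * (n \<bullet> q $ a)) = (\<Sum>a\<in>UNIV. m a * (n \<bullet> q $ None))"
        by (intro sum.cong refl) (metis eq)
      then have "total_mass m * (n \<bullet> mass_center m q) = total_mass m * (n \<bullet> q $ None)"
        unfolding sum_mass_inner by (simp add: total_mass_def sum_distrib_right)
      then have "n \<bullet> mass_center m q = n \<bullet> q $ None" using total_mass_pos by simp
      then show "\<forall>a. n \<bullet> centered q a = 0"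
        unfolding centered_def inner_diff_right by (metis eq diff_self)
    qed (simp add: centered_def inner_diff_right)
    then show ?thesis unfolding moment_eq_0_iff by simp
  qed
  finally show ?thesis .
qed

text \<open>
  The sign factor is harmless: where it vanishes the bodies lie in a hyperplane, and the distance is
  zero as well.
\<close>
lemma S_squared: "(S q)\<^sup>2 = (mass_dist_locus m q)\<^sup>2"
proof (cases "signed_volume q = 0")
  case True
  then obtain n where n: "n \<noteq> 0" "moment q n = 0" unfolding signed_volume_eq_0_iff by blast
  then have "n \<bullet> n > 0" by simp
  moreover have "(mass_dist_locus m q)\<^sup>2 * (n \<bullet> n) \<le> 0"
    using mass_dist_locus_le_moment[of q n] n(2) by simp
  ultimately have "(mass_dist_locus m q)\<^sup>2 \<le> 0" by (metis mult_pos_pos not_less)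
  then show ?thesis using True by (simp add: signed_distance_def)
next
  case False
  then show ?thesis by (simp add: signed_distance_def power_mult_distrib sgn_if)
qed

lemma S_le_moment: "(S q)\<^sup>2 * (n \<bullet> n) \<le> moment q n"
  unfolding S_squared by (rule mass_dist_locus_le_moment)

lemma closest_normal:
  obtains n where "norm n = 1" "moment q n = (S q)\<^sup>2"
  unfolding S_squared by (rule moment_attains_mass_dist_locus)

lemma S_eq_0_iff: "S q = 0 \<longleftrightarrow> signed_volume q = 0"
proof
  assume "S q = 0"
  then obtain n where n: "norm n = 1" "moment q n = 0" using closest_normal[of q] by auto
  then have "n \<noteq> 0" by auto
  then show "signed_volume q = 0" using n unfolding signed_volume_eq_0_iff by blast
qed (simp add: signed_distance_def)

end

section \<open>First and second variation off the degeneration locus\<close>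

lemma linear_coeff_zero_of_nonneg:
  fixes b c :: real
  assumes "\<And>t. 0 \<le> t * b + t\<^sup>2 * c"
  shows "b = 0"
proof -
  have "((\<lambda>t. t * b + t\<^sup>2 * c) has_real_derivative b) (at 0)"
    by (auto intro!: derivative_eq_intros)
  then show ?thesis
    by (rule DERIV_local_min[where d = 1]) (use assms in auto)
qed

context masses begin

lemma moment_add_normal:
  "moment q (n + t *\<^sub>R z) = moment q n
     + t * (2 * (\<Sum>a\<in>UNIV. m a * (n \<bullet> centered q a) * (z \<bullet> centered q a))) + t\<^sup>2 * moment q z"
  unfolding moment_def sum_distrib_left sum.distrib[symmetric]
  by (rule sum.cong) (simp_all add: inner_add_left power2_eq_square algebra_simps)

lemma moment_line:
  "moment (q + t *\<^sub>R v) n = moment q n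
     + t * (2 * (\<Sum>a\<in>UNIV. m a * (n \<bullet> centered q a) * (n \<bullet> centered v a))) + t\<^sup>2 * moment v n"
  unfolding moment_def sum_distrib_left sum.distrib[symmetric] centered_line
  by (rule sum.cong) (simp_all add: inner_add_right power2_eq_square algebra_simps)

text \<open>
  Moving \<open>n\<close> to \<open>n + t z\<close> cannot bring the moment below \<open>S\<^sup>2\<close> times the squared length, so the
  terms linear in \<open>t\<close> agree: \<open>n\<close> is an eigenvector of the inertia matrix.
\<close>
lemma closest_normal_eigenvector:
  assumes n: "norm n = 1" "moment q n = (S q)\<^sup>2"
  shows "(\<Sum>a\<in>UNIV. m a * (n \<bullet> centered q a) * (z \<bullet> centered q a)) = (S q)\<^sup>2 * (n \<bullet> z)"
proof -
  define B where "B = (\<Sum>a\<in>UNIV. m a * (n \<bullet> centered q a) * (z \<bullet> centered q a))"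
  have nn: "n \<bullet> n = 1" using n(1) by (simp add: norm_eq_1)
  have "0 \<le> t * (2 * (B - (S q)\<^sup>2 * (n \<bullet> z))) + t\<^sup>2 * (moment q z - (S q)\<^sup>2 * (z \<bullet> z))" for t
  proof -
    have sq: "(n + t *\<^sub>R z) \<bullet> (n + t *\<^sub>R z) = 1 + t * (2 * (n \<bullet> z)) + t\<^sup>2 * (z \<bullet> z)"
      by (simp add: inner_add_left inner_add_right nn inner_commute power2_eq_square)
    show ?thesis
      using S_le_moment[of q "n + t *\<^sub>R z", unfolded sq moment_add_normal n(2), folded B_def]
      by (simp add: algebra_simps)
  qed
  then have "2 * (B - (S q)\<^sup>2 * (n \<bullet> z)) = 0" by (rule linear_coeff_zero_of_nonneg)
  then show ?thesis by (simp add: B_def)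
qed

text \<open>
  With \<open>n\<close> kept fixed, \<open>moment (q + t w) n - (S (q + t w))\<^sup>2\<close> is nonnegative and vanishes at
  \<open>t = 0\<close>, so its derivative there is zero.
\<close>
lemma S_times_derivative:
  assumes n: "norm n = 1" "moment q n = (S q)\<^sup>2"
    and S: "(S has_derivative dir_deriv S q) (at q)"
  shows "S q * dir_deriv S q w = (\<Sum>a\<in>UNIV. m a * (n \<bullet> centered q a) * (n \<bullet> w $ a))"
proof -
  define B where "B = (\<Sum>a\<in>UNIV. m a * (n \<bullet> centered q a) * (n \<bullet> centered w a))"
  have nn: "n \<bullet> n = 1" using n(1) by (simp add: norm_eq_1)
  let ?\<phi> = "\<lambda>t. (S q)\<^sup>2 + t * (2 * B) + t\<^sup>2 * moment w n - (S (q + t *\<^sub>R w))\<^sup>2"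
  have "(?\<phi> has_real_derivative 2 * B - 2 * S q * dir_deriv S q w) (at 0)"
    using has_derivative_along_line[OF S, of w]
    by (auto intro!: derivative_eq_intros)
  then have "2 * B - 2 * S q * dir_deriv S q w = 0"
  proof (rule DERIV_local_min[where d = 1])
    have "?\<phi> t \<ge> ?\<phi> 0" for t
      using S_le_moment[of "q + t *\<^sub>R w" n] unfolding moment_line nn n(2) B_def[symmetric] by simp
    then show "\<forall>t. \<bar>0 - t\<bar> < 1 \<longrightarrow> ?\<phi> 0 \<le> ?\<phi> t" by blast
  qed simp
  then show ?thesis unfolding B_def sum_mass_centered_mult by simp
qed

text \<open>
  The angular momentum is the antisymmetric part of the bilinear form
  \<open>(u, w) \<mapsto> \<Sum>a. m a * (u \<bullet> x_a) * (w \<bullet> v_a)\<close>.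
\<close>
lemma zero_momentum_symmetric:
  assumes "angular_momentum m q v = 0"
  shows "(\<Sum>a\<in>UNIV. m a * (u \<bullet> centered q a) * (w \<bullet> centered v a))
       = (\<Sum>a\<in>UNIV. m a * (w \<bullet> centered q a) * (u \<bullet> centered v a))"
proof -
  have wedge: "u \<bullet> (wedge x y *v w) = (u \<bullet> x) * (w \<bullet> y) - (w \<bullet> x) * (u \<bullet> y)" for x y :: "real^'d"
  proof -
    have "wedge x y *v w = (w \<bullet> y) *\<^sub>R x - (w \<bullet> x) *\<^sub>R y"
      by (simp add: vec_eq_iff wedge_def matrix_vector_mult_def inner_vec_def
          left_diff_distrib right_diff_distrib sum_subtractf sum_distrib_left mult_ac)
    then show ?thesis by (simp add: inner_diff_right)
  qed
  have lin: "linear (\<lambda>A :: real^'d^'d. u \<bullet> (A *v w))"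
    by (rule linearI)
       (simp_all add: matrix_vector_mult_add_rdistrib inner_add_right scaleR_matrix_vector_assoc[symmetric])
  have "0 = u \<bullet> (angular_momentum m q v *v w)" using assms by simp
  also have "\<dots> = (\<Sum>a\<in>UNIV. m a * ((u \<bullet> centered q a) * (w \<bullet> centered v a)
                                - (w \<bullet> centered q a) * (u \<bullet> centered v a)))"
    unfolding angular_momentum_def linear_sum[OF lin] linear_scale[OF lin] wedge centered_def by simp
  finally show ?thesis by (simp add: right_diff_distrib sum_subtractf mult.assoc)
qed

lemma centered_eq: "centered q a = q $ a - c - (1 / total_mass m) *\<^sub>R (\<Sum>b\<in>UNIV. m b *\<^sub>R (q $ b - c))"
proof -
  have "(\<Sum>b\<in>UNIV. m b *\<^sub>R (q $ b - c)) = (\<Sum>b\<in>UNIV. m b *\<^sub>R q $ b) - total_mass m *\<^sub>R c"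
    by (simp add: scaleR_diff_right sum_subtractf total_mass_def scaleR_sum_left)
  then show ?thesis using total_mass_pos
    by (simp add: centered_def mass_center_def scaleR_diff_right)
qed

text \<open>
  Off the locus the differences to the first body form a basis of the space, so any infinitesimal
  motion of the bodies is the restriction of an affine one.
\<close>
lemma nondegenerate_velocity_linear:
  assumes "S q \<noteq> 0"
  obtains L where "linear L" "\<And>a. centered v a = L (centered q a)"
proof -
  define Q where "Q = (\<chi> i j. (q $ Some j - q $ None) $ i)"
  define V where "V = (\<chi> i j. (v $ Some j - v $ None) $ i)"
  have "det Q \<noteq> 0" using assms unfolding S_eq_0_iff signed_volume_def Q_def .
  then obtain R where inv: "R ** Q = mat 1"
    by (metis invertible_det_nz invertible_left_inverse)
  define L where "L = (\<lambda>x. (V ** R) *v x)"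
  have lin: "linear L" unfolding L_def by simp
  have cols: "Q *v axis j 1 = q $ Some j - q $ None" "V *v axis j 1 = v $ Some j - v $ None" for j
    by (simp_all add: Q_def V_def vec_eq_iff matrix_vector_mult_basis column_def)
  have L: "L (q $ b - q $ None) = v $ b - v $ None" for b
  proof (cases b)
    case None
    then show ?thesis using lin by (simp add: linear_0)
  next
    case (Some j)
    have "L (q $ b - q $ None) = (V ** (R ** Q)) *v axis j 1"
      by (simp only: L_def Some cols(1)[symmetric] matrix_vector_mul_assoc matrix_mul_assoc)
    then show ?thesis by (simp add: inv cols(2) Some)
  qed
  have "centered v a = L (centered q a)" for a
    unfolding centered_eq[of q a "q $ None"] centered_eq[of v a "v $ None"]
    by (simp add: linear_diff[OF lin] linear_scale[OF lin] linear_sum[OF lin]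
        L[unfolded linear_diff[OF lin], symmetric])
  with lin show ?thesis by (rule that)
qed

text \<open>
  Let \<open>centered v a = L (centered q a)\<close> and let \<open>p\<close>, \<open>r\<close> be the images of the closest normal \<open>n\<close>
  under the adjoint of \<open>L\<close> and its square. The adjoint of \<open>1 + t L\<close> maps
  \<open>n - t p + t\<^sup>2 r\<close> to \<open>n\<close> up to a term of order \<open>t\<^sup>3\<close>, so the moment of this moving normal is
  constant up to that order, and all of the second-order information sits in its squared length \<open>N\<close>. Comparison with
  \<open>(S (q + t v))\<^sup>2 * N t\<close> gives
  \<open>S * D\<^sup>2S(v, v) \<le> S\<^sup>2 * (3 (n \<bullet> p)\<^sup>2 - p \<bullet> p - 2 n \<bullet> r)\<close>.
  Vanishing angular momentum and minimality of \<open>n\<close> give \<open>n \<bullet> r \<ge> p \<bullet> p\<close>, and then the Cauchy-Schwarz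
  inequality makes the bracket nonpositive. Working with \<open>S\<^sup>2\<close> treats both signs of \<open>S\<close> at once.
\<close>
lemma S_second_derivative_sign:
  assumes smooth: "smooth_near S q" and J: "angular_momentum m q v = 0" and Sq: "S q \<noteq> 0"
  shows "S q * dir_deriv2 S q v \<le> 0"
proof -
  obtain n where n: "norm n = 1" "moment q n = (S q)\<^sup>2" by (rule closest_normal)
  obtain L where L: "linear L" "\<And>a. centered v a = L (centered q a)"
    using nondegenerate_velocity_linear[OF Sq] by metis
  define p where "p = adjoint L n"
  define r where "r = adjoint L p"
  have p: "n \<bullet> centered v a = p \<bullet> centered q a" and r: "p \<bullet> centered v a = r \<bullet> centered q a" for a
    unfolding p_def r_def L(2) using adjoint_works[OF L(1)] by (metis inner_commute)+
  have nn: "n \<bullet> n = 1" using n(1) by (simp add: norm_eq_1)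
  have r_ge: "p \<bullet> p \<le> n \<bullet> r"
  proof -
    have "(S q)\<^sup>2 * (p \<bullet> p) \<le> moment q p" by (rule S_le_moment)
    also have "\<dots> = (\<Sum>a\<in>UNIV. m a * (p \<bullet> centered q a) * (n \<bullet> centered v a))"
      unfolding moment_def p by (simp add: power2_eq_square mult.assoc)
    also have "\<dots> = (\<Sum>a\<in>UNIV. m a * (n \<bullet> centered q a) * (r \<bullet> centered q a))"
      unfolding zero_momentum_symmetric[OF J, of p n] r ..
    also have "\<dots> = (S q)\<^sup>2 * (n \<bullet> r)" by (rule closest_normal_eigenvector[OF n])
    finally show ?thesis using Sq by simp
  qed
  define \<sigma> where "\<sigma> = (\<lambda>t. S (q + t *\<^sub>R v))"
  define \<sigma>' where "\<sigma>' = (\<lambda>t. dir_deriv S (q + t *\<^sub>R v) v)"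
  define N where "N = (\<lambda>t. 1 - 2 * (n \<bullet> p) * t + (p \<bullet> p + 2 * (n \<bullet> r)) * t\<^sup>2 - 2 * (p \<bullet> r) * t^3 + (r \<bullet> r) * t^4)"
  define N' where "N' = (\<lambda>t. - 2 * (n \<bullet> p) + 2 * (p \<bullet> p + 2 * (n \<bullet> r)) * t - 6 * (p \<bullet> r) * t\<^sup>2 + 4 * (r \<bullet> r) * t^3)"
  define k where "k = (\<Sum>a\<in>UNIV. m a * (n \<bullet> centered q a) * (r \<bullet> centered v a))"
  define l where "l = (\<Sum>a\<in>UNIV. m a * (r \<bullet> centered v a)\<^sup>2)"
  define \<phi> where "\<phi> = (\<lambda>t. (S q)\<^sup>2 + 2 * k * t^3 + l * t^6 - (\<sigma> t)\<^sup>2 * N t)"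
  define \<phi>' where "\<phi>' = (\<lambda>t. 6 * k * t\<^sup>2 + 6 * l * t^5 - (2 * \<sigma> t * \<sigma>' t * N t + (\<sigma> t)\<^sup>2 * N' t))"
  have nonneg: "\<phi> t \<ge> 0" for t
  proof -
    define w where "w = n - t *\<^sub>R p + t\<^sup>2 *\<^sub>R r"
    have "w \<bullet> w = N t"
      unfolding w_def N_def
      by (simp add: inner_add_left inner_add_right inner_diff_left inner_diff_right nn
          inner_commute[of p n] inner_commute[of r n] inner_commute[of r p] algebra_simps
          power2_eq_square power3_eq_cube power4_eq_xxxx)
    moreover have "moment (q + t *\<^sub>R v) w = (S q)\<^sup>2 + 2 * k * t^3 + l * t^6"
    proof -
      have "w \<bullet> centered (q + t *\<^sub>R v) a = n \<bullet> centered q a + t^3 * (r \<bullet> centered v a)" for a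
        unfolding w_def centered_line
        by (simp add: inner_add_left inner_add_right inner_diff_left p r algebra_simps
            power2_eq_square power3_eq_cube)
      then have "moment (q + t *\<^sub>R v) w = (\<Sum>a\<in>UNIV. m a * (n \<bullet> centered q a)\<^sup>2
          + 2 * t^3 * (m a * (n \<bullet> centered q a) * (r \<bullet> centered v a))
          + t^6 * (m a * (r \<bullet> centered v a)\<^sup>2))"
        unfolding moment_def
        by (intro sum.cong) (simp_all add: power2_eq_square algebra_simps flip: power_add)
      then show ?thesis
        unfolding sum.distrib sum_distrib_left[symmetric] n(2)[symmetric] k_def l_def
        by (simp add: moment_def)
    qed
    ultimately show ?thesis
      using S_le_moment[of "q + t *\<^sub>R v" w] by (simp add: \<phi>_def \<sigma>_def)
  qed
  have N_deriv: "(N has_real_derivative N' t) (at t)" for t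
    unfolding N_def N'_def by (auto intro!: derivative_eq_intros)
  have N'_deriv: "(N' has_real_derivative 2 * (p \<bullet> p + 2 * (n \<bullet> r))) (at 0)"
    unfolding N'_def by (auto intro!: derivative_eq_intros)
  have \<sigma>_deriv: "\<forall>\<^sub>F t in nhds 0. (\<sigma> has_real_derivative \<sigma>' t) (at t)"
    and \<sigma>'_deriv: "(\<sigma>' has_real_derivative dir_deriv2 S q v) (at 0)"
    using smooth_near_along_line[OF smooth] unfolding \<sigma>_def \<sigma>'_def by auto
  have \<phi>_deriv: "\<forall>\<^sub>F t in nhds 0. (\<phi> has_real_derivative \<phi>' t) (at t)"
    using \<sigma>_deriv
  proof eventually_elim
    case (elim t)
    show ?case unfolding \<phi>_def \<phi>'_def
      by (auto intro!: derivative_eq_intros elim N_deriv simp: algebra_simps)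
  qed
  have \<sigma>0: "\<sigma> 0 = S q" "\<sigma>' 0 = dir_deriv S q v" by (simp_all add: \<sigma>_def \<sigma>'_def)
  have N0: "N 0 = 1" "N' 0 = - 2 * (n \<bullet> p)" by (simp_all add: N_def N'_def)
  have "S q * dir_deriv S q v = S q * (S q * (n \<bullet> p))"
  proof -
    have "S q * dir_deriv S q v = (\<Sum>a\<in>UNIV. m a * (n \<bullet> centered q a) * (n \<bullet> centered v a))"
      unfolding sum_mass_centered_mult
      by (rule S_times_derivative[OF n smooth_near_has_derivative[OF smooth]])
    also have "\<dots> = (S q)\<^sup>2 * (n \<bullet> p)" unfolding p by (rule closest_normal_eigenvector[OF n])
    finally show ?thesis by (simp add: power2_eq_square)
  qed
  then have dS: "dir_deriv S q v = S q * (n \<bullet> p)" using Sq by simp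
  have \<phi>0: "\<phi> 0 = 0" "\<phi>' 0 = 0"
    by (simp_all add: \<phi>_def \<phi>'_def \<sigma>0 N0 dS power2_eq_square)
  define c where "c = - (2 * (S q * dir_deriv2 S q v)
      - 6 * ((S q)\<^sup>2 * (n \<bullet> p)\<^sup>2) + 2 * ((S q)\<^sup>2 * (p \<bullet> p + 2 * (n \<bullet> r))))"
  have \<phi>'_deriv: "(\<phi>' has_real_derivative c) (at 0)"
    unfolding \<phi>'_def
    by (rule derivative_eq_intros refl \<sigma>'_deriv N_deriv N'_deriv eventually_nhds_x_imp_x[OF \<sigma>_deriv])+
       (simp add: c_def \<sigma>0 N0 dS power2_eq_square algebra_simps)
  have "\<not> c < 0"
  proof
    assume "c < 0"
    then obtain e where "e > 0" "\<And>t. 0 < \<bar>t\<bar> \<Longrightarrow> \<bar>t\<bar> < e \<Longrightarrow> \<phi> t < 0"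
      using negative_of_second_derivative_negative[OF \<phi>_deriv \<phi>'_deriv \<phi>0] by auto
    then have "\<phi> (e / 2) < 0" by simp
    with nonneg[of "e / 2"] show False by simp
  qed
  then have "S q * dir_deriv2 S q v \<le> (S q)\<^sup>2 * (3 * (n \<bullet> p)\<^sup>2 - (p \<bullet> p + 2 * (n \<bullet> r)))"
    by (simp add: c_def algebra_simps)
  also have "\<dots> \<le> 0"
  proof -
    have "(n \<bullet> p)\<^sup>2 \<le> p \<bullet> p" using Cauchy_Schwarz_ineq[of n p] nn by simp
    then have "3 * (n \<bullet> p)\<^sup>2 - (p \<bullet> p + 2 * (n \<bullet> r)) \<le> 0" using r_ge by simp
    then show ?thesis by (simp add: mult_le_0_iff)
  qed
  finally show ?thesis .
qed

end

section \<open>First and second variation on the degeneration locus\<close>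

text \<open>
  The determinant is a polynomial in \<open>t\<close>, and it is not the zero polynomial because
  \<open>Q + t I\<close> is invertible once \<open>t\<close> exceeds the operator norm of \<open>Q\<close>.
\<close>
lemma eventually_det_add_scalar_nonzero:
  fixes Q :: "real^'n^'n"
  shows "\<forall>\<^sub>F t in at 0. det (Q + t *\<^sub>R mat 1) \<noteq> 0"
proof -
  define P where "P = (\<Sum>\<sigma> | \<sigma> permutes (UNIV :: 'n set).
     smult (of_int (sign \<sigma>)) (\<Prod>i\<in>UNIV. [: Q $ i $ \<sigma> i, mat 1 $ i $ \<sigma> i :]))"
  have P: "poly P t = det (Q + t *\<^sub>R mat 1)" for t
    unfolding P_def det_def by (simp add: poly_sum poly_prod)
  have "P \<noteq> 0"
  proof
    assume "P = 0"
    obtain K where K: "K > 0" "\<And>x. norm (Q *v x) \<le> norm x * K"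
      using bounded_linear.pos_bounded[OF matrix_vector_mul_bounded_linear] by blast
    have "det (Q + (K + 1) *\<^sub>R mat 1) = 0" using P[of "K + 1"] \<open>P = 0\<close> by simp
    then obtain x where x: "x \<noteq> 0" "(Q + (K + 1) *\<^sub>R mat 1) *v x = 0"
      by (metis invertible_det_nz invertible_left_inverse matrix_left_invertible_ker)
    then have "Q *v x = - ((K + 1) *\<^sub>R x)"
      by (simp add: matrix_vector_mult_add_rdistrib scaleR_matrix_vector_assoc[symmetric]
          eq_neg_iff_add_eq_0)
    then have "(K + 1) * norm x \<le> norm x * K" using K(2)[of x] K(1) by simp
    then show False using x(1) by (simp add: algebra_simps)
  qed
  then have "finite {t. poly P t = 0}" by (rule poly_roots_finite)
  then have "open (- ({t. poly P t = 0} - {0}))"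
    by (intro open_Compl finite_imp_closed finite_Diff)
  then have "\<forall>\<^sub>F t in at 0. t \<in> - ({t. poly P t = 0} - {0})"
    by (intro eventually_at_in_open') auto
  moreover have "\<forall>\<^sub>F t in at (0::real). t \<noteq> 0" by (rule eventually_neq_at_within)
  ultimately show ?thesis by eventually_elim (simp add: P)
qed

context masses begin

lemma S_nonzero_nearby:
  assumes "open U" "q \<in> U"
  obtains x where "x \<in> U" "S x \<noteq> 0"
proof -
  define e :: "'d configuration" where "e = (\<chi> a. case a of None \<Rightarrow> 0 | Some j \<Rightarrow> axis j 1)"
  define Q where "Q = (\<chi> i j. (q $ Some j - q $ None) $ i)"
  have "(\<chi> i j. ((q + t *\<^sub>R e) $ Some j - (q + t *\<^sub>R e) $ None) $ i) = Q + t *\<^sub>R mat 1" for t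
    by (simp add: vec_eq_iff Q_def e_def mat_def axis_def)
  then have "signed_volume (q + t *\<^sub>R e) = det (Q + t *\<^sub>R mat 1)" for t
    unfolding signed_volume_def by simp
  then have "\<forall>\<^sub>F t in at 0. S (q + t *\<^sub>R e) \<noteq> 0"
    unfolding S_eq_0_iff using eventually_det_add_scalar_nonzero[of Q] by simp
  moreover have "((\<lambda>t. q + t *\<^sub>R e) \<longlongrightarrow> q + 0 *\<^sub>R e) (at 0)" by (intro tendsto_intros)
  then have "\<forall>\<^sub>F t in at 0. q + t *\<^sub>R e \<in> U" using topological_tendstoD assms by fastforce
  ultimately have "\<forall>\<^sub>F t in at (0::real). q + t *\<^sub>R e \<in> U \<and> S (q + t *\<^sub>R e) \<noteq> 0"
    by (rule eventually_elim2) auto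
  then obtain t :: real where "q + t *\<^sub>R e \<in> U" "S (q + t *\<^sub>R e) \<noteq> 0"
    using eventually_happens'[OF at_neq_bot] by blast
  then show ?thesis by (rule that)
qed

text \<open>
  In the direction \<open>w_a = (n \<bullet> x_a) n\<close> pointing away from the closest degenerate configuration,
  \<open>DS(w)\<close> equals \<open>S\<close>, whose absolute value is the mass norm of \<open>w\<close>. Passing to the Euclidean norm
  costs a factor depending on the masses only, so the bound survives limits.
\<close>
lemma gradient_bound_off_locus:
  assumes S: "(S has_derivative dir_deriv S q) (at q)" and Sq: "S q \<noteq> 0"
  shows "1 \<le> (\<Sum>b\<in>Basis. (dir_deriv S q b)\<^sup>2) * (\<Sum>a\<in>UNIV. 1 / m a)"
proof -
  obtain n where n: "norm n = 1" "moment q n = (S q)\<^sup>2" by (rule closest_normal)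
  have nn: "n \<bullet> n = 1" using n(1) by (simp add: norm_eq_1)
  define w :: "'d configuration" where "w = (\<chi> a. (n \<bullet> centered q a) *\<^sub>R n)"
  define D where "D = (\<Sum>b\<in>Basis. dir_deriv S q b *\<^sub>R b)"
  have lin: "linear (dir_deriv S q)" using S by (rule has_derivative_linear)
  have "dir_deriv S q w = dir_deriv S q (\<Sum>b\<in>Basis. (w \<bullet> b) *\<^sub>R b)"
    by (simp add: euclidean_representation)
  also have "\<dots> = w \<bullet> D"
    by (simp add: linear_sum[OF lin] linear_scale[OF lin] D_def inner_sum_right mult.commute)
  finally have wD: "dir_deriv S q w = w \<bullet> D" .
  have DD: "D \<bullet> D = (\<Sum>b\<in>Basis. (dir_deriv S q b)\<^sup>2)"
    unfolding power2_eq_square by (subst euclidean_inner) (simp add: D_def)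
  have "S q * dir_deriv S q w = (S q)\<^sup>2"
    unfolding S_times_derivative[OF n S] n(2)[symmetric] moment_def
    by (simp add: w_def nn power2_eq_square mult.assoc)
  then have "dir_deriv S q w = S q" using Sq by (simp add: power2_eq_square)
  then have "(S q)\<^sup>2 = (w \<bullet> D)\<^sup>2" using wD by simp
  also have "\<dots> \<le> (w \<bullet> w) * (D \<bullet> D)" by (rule Cauchy_Schwarz_ineq)
  also have "\<dots> \<le> ((S q)\<^sup>2 * (\<Sum>a\<in>UNIV. 1 / m a)) * (D \<bullet> D)"
  proof (rule mult_right_mono)
    have "w \<bullet> w = (\<Sum>a\<in>UNIV. m a * (n \<bullet> centered q a)\<^sup>2 * (1 / m a))"
      unfolding inner_vec_def[of w w] using mass_pos
      by (intro sum.cong) (auto simp: w_def nn power2_eq_square less_imp_neq[symmetric])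
    also have "\<dots> \<le> (\<Sum>a\<in>UNIV. (S q)\<^sup>2 * (1 / m a))"
    proof (intro sum_mono mult_right_mono)
      fix a
      show "m a * (n \<bullet> centered q a)\<^sup>2 \<le> (S q)\<^sup>2"
        unfolding n(2)[symmetric] moment_def
        by (rule member_le_sum) (auto intro: mult_nonneg_nonneg less_imp_le[OF mass_pos])
      show "0 \<le> 1 / m a" using mass_pos[of a] by simp
    qed
    finally show "w \<bullet> w \<le> (S q)\<^sup>2 * (\<Sum>a\<in>UNIV. 1 / m a)" by (simp add: sum_distrib_left)
  qed simp
  finally show ?thesis using Sq by (simp add: DD mult.assoc mult.commute[of "D \<bullet> D"] flip: DD)
qed

text \<open>
  Off the locus the gradient is bounded below uniformly, and the complement of the locus is dense, so
  the bound persists at every point near which \<open>S\<close> is smooth.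
\<close>
lemma gradient_nonzero:
  assumes "smooth_near S q"
  shows "\<exists>w. dir_deriv S q w \<noteq> 0"
proof (rule ccontr)
  assume "\<not> ?thesis"
  then have zero: "dir_deriv S q w = 0" for w by simp
  obtain U where U: "open U" "q \<in> U"
    "\<And>x. x \<in> U \<Longrightarrow> (S has_derivative dir_deriv S x) (at x)"
    "\<And>x w. x \<in> U \<Longrightarrow>
       ((\<lambda>y. dir_deriv S y w) has_derivative dir_deriv (\<lambda>y. dir_deriv S y w) x) (at x)"
    using smooth_near_C2[OF assms] by blast
  define h where "h x = (\<Sum>b\<in>Basis. (dir_deriv S x b)\<^sup>2) * (\<Sum>a\<in>UNIV. 1 / m a)" for x
  have "continuous_on U (\<lambda>x. dir_deriv S x b)" for b
    using U(4) has_derivative_continuous by (intro continuous_at_imp_continuous_on) blast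
  then have "continuous_on U h" unfolding h_def by (intro continuous_intros)
  then have "open (h -` {..<1} \<inter> U)"
    using U(1) by (metis Int_commute continuous_on_open_vimage open_lessThan)
  moreover have "h q = 0" by (simp add: h_def zero)
  ultimately obtain x where "x \<in> h -` {..<1} \<inter> U" "S x \<noteq> 0"
    using S_nonzero_nearby[of "h -` {..<1} \<inter> U" q] U(2) by auto
  then show False using gradient_bound_off_locus[OF U(3), of x] by (simp add: h_def)
qed

text \<open>
  Displacements along the hyperplane of the bodies stay in the locus, where \<open>S\<close> is zero.
\<close>
lemma derivative_in_locus_direction:
  assumes S: "(S has_derivative dir_deriv S q) (at q)"
    and n: "norm n = 1" "moment q n = 0" and w: "\<And>a. n \<bullet> centered w a = 0"
  shows "dir_deriv S q w = 0"
proof -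
  have zero: "S (q + t *\<^sub>R w) = 0" for t
  proof -
    have "moment (q + t *\<^sub>R w) n = 0"
      using n(2) w unfolding moment_eq_0_iff centered_line by (simp add: inner_add_right)
    then have "(S (q + t *\<^sub>R w))\<^sup>2 \<le> 0"
      using S_le_moment[of "q + t *\<^sub>R w" n] n(1) by (simp add: norm_eq_1)
    then show ?thesis by simp
  qed
  show ?thesis
    using has_derivative_along_line[OF S, of w] unfolding zero by (metis DERIV_const DERIV_unique)
qed

lemma centered_normal_field:
  "centered (\<chi> a. c a *\<^sub>R n) a = (c a - (\<Sum>b\<in>UNIV. m b * c b) / total_mass m) *\<^sub>R n"
  unfolding centered_def mass_center_def
  by (simp add: scaleR_diff_left flip: scaleR_sum_left)

text \<open>
  If the bodies also lay in a hyperplane with normal \<open>u\<close>, then motions along \<open>n\<close> would keep them in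
  that hyperplane and motions orthogonal to \<open>n\<close> in the first one. The derivative of \<open>S\<close> would vanish in
  all directions, against \<open>gradient_nonzero\<close>.
\<close>
lemma coplanar_normal_unique:
  assumes smooth: "smooth_near S q"
    and n: "norm n = 1" "moment q n = 0" and u: "norm u = 1" "n \<bullet> u = 0"
  shows "moment q u > 0"
proof (rule ccontr)
  assume "\<not> ?thesis"
  then have u0: "moment q u = 0" using moment_nonneg[of q u] by simp
  have S: "(S has_derivative dir_deriv S q) (at q)" by (rule smooth_near_has_derivative[OF smooth])
  have nn: "n \<bullet> n = 1" using n(1) by (simp add: norm_eq_1)
  have "dir_deriv S q w = 0" for w
  proof -
    define w' :: "'d configuration" where "w' = (\<chi> a. (n \<bullet> centered w a) *\<^sub>R n)"
    have w': "centered w' a = (n \<bullet> centered w a) *\<^sub>R n" for a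
      unfolding w'_def centered_normal_field sum_mass_centered by simp
    have "dir_deriv S q w' = 0"
      by (rule derivative_in_locus_direction[OF S u(1) u0]) (simp add: w' inner_commute u(2))
    moreover have "dir_deriv S q (w - w') = 0"
      by (rule derivative_in_locus_direction[OF S n])
         (use centered_line[of w "-1" w'] in \<open>simp add: w' inner_diff_right nn\<close>)
    ultimately show ?thesis
      using linear_diff[OF has_derivative_linear[OF S], of w w'] by simp
  qed
  then show False using gradient_nonzero[OF smooth] by blast
qed

lemma coplanar_moment_lower_bound:
  assumes smooth: "smooth_near S q" and n: "norm n = 1" "moment q n = 0"
  obtains \<mu> where "\<mu> > 0" "\<And>u. n \<bullet> u = 0 \<Longrightarrow> \<mu> * (u \<bullet> u) \<le> moment q u"
proof -
  define K where "K = sphere 0 1 \<inter> {u. n \<bullet> u = 0}"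
  have "compact K" unfolding K_def by (intro compact_Int_closed compact_sphere closed_hyperplane)
  obtain \<mu> where \<mu>: "\<mu> > 0" "\<And>u. u \<in> K \<Longrightarrow> \<mu> \<le> moment q u"
  proof (cases "K = {}")
    case True
    then show ?thesis using that[of 1] by simp
  next
    case False
    then obtain x where "x \<in> K" "\<And>u. u \<in> K \<Longrightarrow> moment q x \<le> moment q u"
      using continuous_attains_inf[OF \<open>compact K\<close> _ continuous_on_moment] by blast
    then show ?thesis using that[of "moment q x"] coplanar_normal_unique[OF smooth n, of x]
      by (auto simp: K_def)
  qed
  have "\<mu> * (u \<bullet> u) \<le> moment q u" if "n \<bullet> u = 0" for u
  proof (cases "u = 0")
    case False
    then have "\<mu> \<le> moment q ((1 / norm u) *\<^sub>R u)" using that by (intro \<mu>(2)) (simp add: K_def)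
    then show ?thesis using False
      by (simp add: moment_scaleR power_divide field_simps flip: power2_norm_eq_inner)
  qed simp
  then show ?thesis using \<mu>(1) that by blast
qed

text \<open>
  For a normal displacement orthogonal to the positions the inertia form splits as the sum of the
  form of \<open>q\<close> on the hyperplane and \<open>t\<^sup>2 * moment w n\<close> in the normal direction. The former is bounded
  below by some \<open>\<mu> > 0\<close>, so for small \<open>t\<close> the normal direction carries the smallest eigenvalue and
  \<open>(S (q + t w))\<^sup>2\<close> is exactly \<open>t\<^sup>2 * moment w n\<close>.
\<close>
lemma coplanar_normal_derivative:
  assumes smooth: "smooth_near S q" and n: "norm n = 1" "moment q n = 0"
    and w: "\<And>a. centered w a = \<eta> a *\<^sub>R n"
    and orth: "\<And>u. (\<Sum>a\<in>UNIV. m a * (u \<bullet> centered q a) * \<eta> a) = 0"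
  shows "(dir_deriv S q w)\<^sup>2 = moment w n"
proof -
  have nn: "n \<bullet> n = 1" using n(1) by (simp add: norm_eq_1)
  obtain \<mu> where \<mu>: "\<mu> > 0" "\<And>u. n \<bullet> u = 0 \<Longrightarrow> \<mu> * (u \<bullet> u) \<le> moment q u"
    using coplanar_moment_lower_bound[OF smooth n] by metis
  have S0: "S q = 0"
    using S_le_moment[of q n] n(2) nn by simp
  have sq: "(S (q + t *\<^sub>R w))\<^sup>2 = t\<^sup>2 * moment w n" if t: "t\<^sup>2 * moment w n \<le> \<mu>" for t
  proof (rule antisym)
    have qn: "n \<bullet> centered q a = 0" for a using n(2) unfolding moment_eq_0_iff by blast
    show "(S (q + t *\<^sub>R w))\<^sup>2 \<le> t\<^sup>2 * moment w n"
      using S_le_moment[of "q + t *\<^sub>R w" n] unfolding moment_line nn n(2) by (simp add: qn)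
    obtain k where k: "norm k = 1" "moment (q + t *\<^sub>R w) k = (S (q + t *\<^sub>R w))\<^sup>2"
      by (rule closest_normal)
    define \<alpha> where "\<alpha> = n \<bullet> k"
    define u where "u = k - \<alpha> *\<^sub>R n"
    have un: "n \<bullet> u = 0" by (simp add: u_def \<alpha>_def inner_diff_right nn)
    have kk: "k \<bullet> k = 1" using k(1) by (simp add: norm_eq_1)
    have uu: "u \<bullet> u = 1 - \<alpha>\<^sup>2"
      by (simp add: u_def inner_diff_left inner_diff_right nn kk inner_commute[of k n]
          power2_eq_square flip: \<alpha>_def)
    have "k \<bullet> centered q a = u \<bullet> centered q a" for a
      by (simp add: u_def inner_diff_left qn)
    then have "moment q k = moment q u" by (simp add: moment_def)
    moreover have "k \<bullet> centered w a = \<alpha> * (n \<bullet> centered w a)" for a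
      by (simp add: w nn \<alpha>_def inner_commute[of k n])
    then have "moment w k = \<alpha>\<^sup>2 * moment w n"
      by (simp add: moment_def power_mult_distrib sum_distrib_left mult.left_commute)
    moreover have "(\<Sum>a\<in>UNIV. m a * (k \<bullet> centered q a) * (k \<bullet> centered w a)) = 0"
      using orth[of k] by (simp add: w mult.assoc[symmetric] flip: sum_distrib_right)
    ultimately have "(S (q + t *\<^sub>R w))\<^sup>2 = moment q u + t\<^sup>2 * (\<alpha>\<^sup>2 * moment w n)"
      unfolding k(2)[symmetric] moment_line by simp
    also have "\<dots> \<ge> \<mu> * (u \<bullet> u) + t\<^sup>2 * (\<alpha>\<^sup>2 * moment w n)" using \<mu>(2)[OF un] by simp
    finally have "\<mu> * (u \<bullet> u) + t\<^sup>2 * (\<alpha>\<^sup>2 * moment w n) \<le> (S (q + t *\<^sub>R w))\<^sup>2" .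
    moreover have "(t\<^sup>2 * moment w n) * (u \<bullet> u) \<le> \<mu> * (u \<bullet> u)" using t by (rule mult_right_mono) simp
    ultimately show "t\<^sup>2 * moment w n \<le> (S (q + t *\<^sub>R w))\<^sup>2"
      by (simp add: uu algebra_simps)
  qed
  have "((\<lambda>t. (S (q + t *\<^sub>R w) - S (q + 0 *\<^sub>R w)) / (t - 0)) \<longlongrightarrow> dir_deriv S q w) (at 0)"
    using has_derivative_along_line[OF smooth_near_has_derivative[OF smooth], of w]
    unfolding has_field_derivative_iff by simp
  then have "((\<lambda>t. (S (q + t *\<^sub>R w) / t)\<^sup>2) \<longlongrightarrow> (dir_deriv S q w)\<^sup>2) (at 0)"
    using S0 by (intro tendsto_power) simp
  moreover have "\<forall>\<^sub>F t in at 0. (S (q + t *\<^sub>R w) / t)\<^sup>2 = moment w n"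
  proof -
    have "((\<lambda>t::real. t\<^sup>2 * moment w n) \<longlongrightarrow> 0\<^sup>2 * moment w n) (at 0)" by (intro tendsto_intros)
    then have "\<forall>\<^sub>F t in at (0::real). t\<^sup>2 * moment w n < \<mu>"
      using \<mu>(1) by (intro order_tendstoD) simp_all
    moreover have "\<forall>\<^sub>F t in at (0::real). t \<noteq> 0" by (rule eventually_neq_at_within)
    ultimately show ?thesis by eventually_elim (simp add: power_divide sq)
  qed
  then have "((\<lambda>t. (S (q + t *\<^sub>R w) / t)\<^sup>2) \<longlongrightarrow> moment w n) (at 0)"
    by (rule tendsto_eventually)
  ultimately show ?thesis using tendsto_unique[OF at_neq_bot] by blast
qed

text \<open>
  With \<open>k = DS(v)\<close>, testing the moment at \<open>n\<close> gives \<open>(S (q + t v))\<^sup>2 \<le> t\<^sup>2 * moment v n\<close>, and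
  \<open>moment v n = k\<^sup>2\<close> because vanishing angular momentum makes the normal velocities orthogonal to
  the positions. Hence \<open>k * (S (q + t v) - k t)\<close>, which vanishes to first order, is \<open>\<le> 0\<close> for
  \<open>t > 0\<close> and \<open>\<ge> 0\<close> for \<open>t < 0\<close>, which rules out either sign of the second derivative.
\<close>
lemma S_second_derivative_on_locus:
  assumes smooth: "smooth_near S q" and J: "angular_momentum m q v = 0" and Sq: "S q = 0"
  shows "dir_deriv2 S q v = 0"
proof -
  obtain n where n: "norm n = 1" "moment q n = (S q)\<^sup>2" by (rule closest_normal)
  have nn: "n \<bullet> n = 1" using n(1) by (simp add: norm_eq_1)
  have n0: "moment q n = 0" using n(2) Sq by simp
  then have qn: "n \<bullet> centered q a = 0" for a unfolding moment_eq_0_iff by blast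
  note S = smooth_near_has_derivative[OF smooth]
  define \<eta> where "\<eta> a = n \<bullet> centered v a" for a
  define w :: "'d configuration" where "w = (\<chi> a. \<eta> a *\<^sub>R n)"
  have w: "centered w a = \<eta> a *\<^sub>R n" for a
    unfolding w_def centered_normal_field \<eta>_def sum_mass_centered by simp
  define k where "k = dir_deriv S q v"
  have "k = dir_deriv S q w"
  proof -
    have "dir_deriv S q (v - w) = 0"
      by (rule derivative_in_locus_direction[OF S n(1) n0])
         (use centered_line[of v "-1" w] in \<open>simp add: w inner_diff_right nn \<eta>_def\<close>)
    then show ?thesis
      using linear_diff[OF has_derivative_linear[OF S], of v w] by (simp add: k_def)
  qed
  moreover have "(dir_deriv S q w)\<^sup>2 = moment w n"
  proof (rule coplanar_normal_derivative[OF smooth n(1) n0 w])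
    show "(\<Sum>a\<in>UNIV. m a * (u \<bullet> centered q a) * \<eta> a) = 0" for u
      using zero_momentum_symmetric[OF J, of u n] by (simp add: \<eta>_def qn)
  qed
  moreover have "moment w n = moment v n" by (simp add: moment_def w nn \<eta>_def)
  ultimately have k2: "k\<^sup>2 = moment v n" by simp
  define \<sigma> where "\<sigma> = (\<lambda>t. S (q + t *\<^sub>R v))"
  define \<sigma>' where "\<sigma>' = (\<lambda>t. dir_deriv S (q + t *\<^sub>R v) v)"
  have \<sigma>_deriv: "\<forall>\<^sub>F t in nhds 0. (\<sigma> has_real_derivative \<sigma>' t) (at t)"
    and \<sigma>'_deriv: "(\<sigma>' has_real_derivative dir_deriv2 S q v) (at 0)"
    using smooth_near_along_line[OF smooth] unfolding \<sigma>_def \<sigma>'_def by auto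
  have \<sigma>0: "\<sigma> 0 = 0" "\<sigma>' 0 = k" by (simp_all add: \<sigma>_def \<sigma>'_def Sq k_def)
  have "(\<sigma> t)\<^sup>2 \<le> t\<^sup>2 * k\<^sup>2" for t
    using S_le_moment[of "q + t *\<^sub>R v" n] unfolding moment_line nn n0 by (simp add: qn k2 \<sigma>_def)
  then have bound: "\<bar>\<sigma> t\<bar> \<le> \<bar>t\<bar> * \<bar>k\<bar>" for t
    by (metis abs_mult power2_le_iff_abs_le power_mult_distrib abs_ge_zero abs_le_square_iff)
  show ?thesis
  proof (cases "k = 0")
    case True
    then have "\<sigma> = (\<lambda>_. 0)" using bound by auto
    then have "\<forall>\<^sub>F t in nhds 0. \<sigma>' t = 0"
      using \<sigma>_deriv by (auto elim!: eventually_mono intro: DERIV_unique)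
    then have "(\<sigma>' has_real_derivative 0) (at 0)"
      by (subst DERIV_cong_ev[OF refl _ refl, of _ "\<lambda>_. 0"]) auto
    then show ?thesis using \<sigma>'_deriv DERIV_unique by blast
  next
    case False
    have no_neg: "\<not> s * (k * dir_deriv2 S q v) < 0" if s: "s = 1 \<or> s = -1" for s
    proof
      assume neg: "s * (k * dir_deriv2 S q v) < 0"
      define \<phi> where "\<phi> t = s * (k * (\<sigma> t - k * t))" for t
      have 1: "\<forall>\<^sub>F t in nhds 0. (\<phi> has_real_derivative s * (k * (\<sigma>' t - k))) (at t)"
        using \<sigma>_deriv
      proof eventually_elim
        case (elim t)
        show ?case unfolding \<phi>_def by (auto intro!: derivative_eq_intros elim)
      qed
      have 2: "((\<lambda>t. s * (k * (\<sigma>' t - k))) has_real_derivative s * (k * dir_deriv2 S q v)) (at 0)"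
        by (auto intro!: derivative_eq_intros \<sigma>'_deriv)
      obtain e where e: "e > 0" "\<And>t. 0 < \<bar>t\<bar> \<Longrightarrow> \<bar>t\<bar> < e \<Longrightarrow> \<phi> t < 0"
        using negative_of_second_derivative_negative[OF 1 2 _ _ neg] by (auto simp: \<phi>_def \<sigma>0)
      have upper: "k * \<sigma> t \<le> \<bar>t\<bar> * k\<^sup>2" for t
      proof -
        have "k * \<sigma> t \<le> \<bar>k\<bar> * \<bar>\<sigma> t\<bar>" by (simp add: abs_mult[symmetric])
        also have "\<dots> \<le> \<bar>k\<bar> * (\<bar>t\<bar> * \<bar>k\<bar>)" by (intro mult_left_mono bound) simp
        finally show ?thesis by (simp add: power2_eq_square mult_ac abs_mult_self_eq)
      qed
      have lower: "- (\<bar>t\<bar> * k\<^sup>2) \<le> k * \<sigma> t" for t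
      proof -
        have "- (k * \<sigma> t) \<le> \<bar>k\<bar> * \<bar>\<sigma> t\<bar>" by (simp add: abs_mult[symmetric])
        also have "\<dots> \<le> \<bar>k\<bar> * (\<bar>t\<bar> * \<bar>k\<bar>)" by (intro mult_left_mono bound) simp
        finally show ?thesis by (simp add: power2_eq_square mult_ac abs_mult_self_eq)
      qed
      \<comment> \<open>The side of \<open>0\<close> on which the linear bound contradicts a negative second derivative.\<close>
      have "\<phi> (- s * (e / 2)) \<ge> 0"
        using s upper[of "e / 2"] lower[of "- (e / 2)"] e(1)
        by (auto simp: \<phi>_def algebra_simps power2_eq_square)
      moreover have "\<phi> (- s * (e / 2)) < 0" using s e(1) by (intro e(2)) auto
      ultimately show False by simp
    qed
    show ?thesis using no_neg[of 1] no_neg[of "-1"] False by (auto simp: not_less mult_le_0_iff zero_le_mult_iff)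
  qed
qed

end

section \<open>The force of a two-body potential\<close>

definition two_body_derivative ::
    "real \<Rightarrow> ('d option \<Rightarrow> real) \<Rightarrow> ('d option \<Rightarrow> 'd option \<Rightarrow> real \<Rightarrow> real)
      \<Rightarrow> 'd::finite configuration \<Rightarrow> 'd configuration \<Rightarrow> real" where
  "two_body_derivative G m f' q w =
    G * ((\<Sum>(a, b) | a \<noteq> b. m a * m b * (f' a b (dist (q $ a) (q $ b)) / dist (q $ a) (q $ b))
            * ((q $ a - q $ b) \<bullet> (w $ a - w $ b))) / 2)"

lemma has_derivative_two_body_potential:
  assumes f: "\<And>a b r. a \<noteq> b \<Longrightarrow> r > 0 \<Longrightarrow> (f a b has_real_derivative f' a b r) (at r)"
    and q: "collision_free q"
  shows "(two_body_potential G m f has_derivative two_body_derivative G m f' q) (at q)"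
proof -
  have pair: "((\<lambda>x. m a * m b * f a b (dist (x $ a) (x $ b))) has_derivative
      (\<lambda>w. m a * m b * (f' a b (dist (q $ a) (q $ b)) / dist (q $ a) (q $ b))
            * ((q $ a - q $ b) \<bullet> (w $ a - w $ b)))) (at q)"
    if ab: "a \<noteq> b" for a b
  proof -
    let ?d = "dist (q $ a) (q $ b)"
    have pos: "?d > 0" using q ab unfolding collision_free_def by blast
    have lin: "((\<lambda>x. x $ a - x $ b) has_derivative (\<lambda>w. w $ a - w $ b)) (at q)"
      by (intro has_derivative_diff bounded_linear_imp_has_derivative bounded_linear_vec_nth)
    have "((\<lambda>x. norm (x $ a - x $ b)) has_derivative (\<lambda>w. (w $ a - w $ b) \<bullet> sgn (q $ a - q $ b))) (at q)"
      by (rule has_derivative_compose[OF lin]) (rule has_derivative_norm, use pos in simp)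
    then have "((\<lambda>x. dist (x $ a) (x $ b)) has_derivative
        (\<lambda>w. ((q $ a - q $ b) \<bullet> (w $ a - w $ b)) / ?d)) (at q)"
      by (simp add: dist_norm sgn_div_norm inner_commute divide_inverse mult.commute)
    from has_derivative_compose[OF this f[OF ab pos, unfolded has_field_derivative_def]]
    have "((\<lambda>x. f a b (dist (x $ a) (x $ b))) has_derivative
        (\<lambda>w. f' a b ?d * (((q $ a - q $ b) \<bullet> (w $ a - w $ b)) / ?d))) (at q)" .
    from has_derivative_mult_right[OF this, of "m a * m b"] show ?thesis
      by (simp add: mult.assoc)
  qed
  have "((\<lambda>x. G * ((\<Sum>p | fst p \<noteq> snd p. m (fst p) * m (snd p) * f (fst p) (snd p) (dist (x $ fst p) (x $ snd p))) / 2))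
    has_derivative (\<lambda>w. G * ((\<Sum>p | fst p \<noteq> snd p. m (fst p) * m (snd p)
       * (f' (fst p) (snd p) (dist (q $ fst p) (q $ snd p)) / dist (q $ fst p) (q $ snd p))
            * ((q $ fst p - q $ snd p) \<bullet> (w $ fst p - w $ snd p))) / 2))) (at q)"
    unfolding divide_inverse[of _ 2]
    by (rule has_derivative_mult_right, rule has_derivative_mult_left, rule has_derivative_sum,
        rule pair) simp
  then show ?thesis
    unfolding two_body_potential_def[abs_def] two_body_derivative_def[abs_def] case_prod_unfold .
qed

text \<open>
  The force law that \<^const>\<open>newton_solution\<close> imposes at a single instant.
\<close>
definition newton_force ::
    "('d option \<Rightarrow> real) \<Rightarrow> ('d::finite configuration \<Rightarrow> real)
      \<Rightarrow> 'd configuration \<Rightarrow> 'd configuration \<Rightarrow> bool" where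
  "newton_force m V q acc \<longleftrightarrow>
    (\<forall>a. GDERIV (\<lambda>x. V (\<chi> b. if b = a then x else q $ b)) (q $ a) :> - (m a *\<^sub>R acc $ a))"

text \<open>
  Newton's equations prescribe the partial gradients body by body; summed up they say that the mass
  inner product of the acceleration with any displacement is minus the total derivative of the
  potential.
\<close>
lemma newton_force_dual:
  fixes q acc :: "'d::finite configuration"
  assumes V: "(V has_derivative V') (at q)"
    and force: "newton_force m V q acc"
  shows "(\<Sum>a\<in>UNIV. m a * (w $ a \<bullet> acc $ a)) = - V' w"
proof -
  have V'_lin: "linear V'" using V by (rule has_derivative_linear)
  have single: "m a * (h \<bullet> acc $ a) = - V' (axis a h)" for a h
  proof -
    have slice: "(\<chi> b. if b = a then x else q $ b) = q + axis a (x - q $ a)" for x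
      by (auto simp: vec_eq_iff axis_def)
    have "linear (axis a :: real^'d \<Rightarrow> 'd configuration)"
      by (rule linearI) (auto simp: vec_eq_iff axis_def)
    then have "bounded_linear (axis a :: real^'d \<Rightarrow> 'd configuration)"
      by (simp add: linear_conv_bounded_linear)
    moreover have "((\<lambda>x. x - q $ a) has_derivative (\<lambda>h. h)) (at (q $ a))"
      by (auto intro!: derivative_eq_intros)
    ultimately have "((\<lambda>x. axis a (x - q $ a) :: 'd configuration) has_derivative axis a) (at (q $ a))"
      by (rule bounded_linear.has_derivative)
    then have "((\<lambda>x. q + axis a (x - q $ a)) has_derivative axis a) (at (q $ a))"
      by (rule has_derivative_add_const[where c = q, unfolded add.commute[of _ q]])
    moreover have "q + axis a (q $ a - q $ a) = q" by (simp add: vec_eq_iff axis_def)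
    then have "(V has_derivative V') (at (q + axis a (q $ a - q $ a)))" using V by (simp only:)
    ultimately have "((\<lambda>x. V (q + axis a (x - q $ a))) has_derivative (\<lambda>h. V' (axis a h))) (at (q $ a))"
      by (rule has_derivative_compose)
    moreover have "((\<lambda>x. V (q + axis a (x - q $ a))) has_derivative (\<lambda>h. h \<bullet> - (m a *\<^sub>R acc $ a))) (at (q $ a))"
      using force[unfolded newton_force_def gderiv_def, rule_format, of a] unfolding slice .
    ultimately have "(\<lambda>h. V' (axis a h)) = (\<lambda>h. h \<bullet> - (m a *\<^sub>R acc $ a))"
      by (rule has_derivative_unique)
    then show ?thesis by (simp add: fun_eq_iff)
  qed
  have "w = (\<Sum>a\<in>UNIV. axis a (w $ a))"
    by (simp add: vec_eq_iff axis_def if_distrib[where f = "\<lambda>x. x $ _"] cong: if_cong)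
  then have "V' w = (\<Sum>a\<in>UNIV. V' (axis a (w $ a)))"
    by (metis linear_sum[OF V'_lin])
  then show ?thesis by (simp add: single sum_negf)
qed

context masses begin

text \<open>
  Lagrange's identity for the coordinate along \<open>n\<close>; the factor \<open>2\<close> is due to ordered pairs.
\<close>
lemma pair_moment:
  "(\<Sum>(a, b) | a \<noteq> b. m a * m b * (n \<bullet> (q $ a - q $ b))\<^sup>2) = 2 * total_mass m * moment q n"
proof -
  have "(\<Sum>(a, b) | a \<noteq> b. m a * m b * (n \<bullet> (q $ a - q $ b))\<^sup>2)
      = (\<Sum>(a, b)\<in>UNIV \<times> UNIV. m a * m b * (n \<bullet> (q $ a - q $ b))\<^sup>2)"
    by (rule sum.mono_neutral_left) auto
  also have "\<dots> = (\<Sum>a\<in>UNIV. m a * (\<Sum>b\<in>UNIV. m b * (n \<bullet> q $ b - n \<bullet> q $ a)\<^sup>2))"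
    unfolding sum.cartesian_product[symmetric] sum_distrib_left
    by (intro sum.cong) (simp_all add: inner_diff_right power2_eq_square algebra_simps)
  also have "\<dots> = (\<Sum>a\<in>UNIV. m a * moment q n + total_mass m * (m a * (n \<bullet> centered q a)\<^sup>2))"
    unfolding parallel_axis centered_def
    by (intro sum.cong)
       (simp_all add: inner_diff_right power2_eq_square algebra_simps)
  also have "\<dots> = 2 * total_mass m * moment q n"
    unfolding sum.distrib sum_distrib_left[symmetric] sum_distrib_right[symmetric]
      moment_def[symmetric] total_mass_def[symmetric] by simp
  finally show ?thesis .
qed

section \<open>The oscillator equation\<close>

text \<open>
  The number \<open>\<gamma>\<close> is the value of \<open>g\<close> at \<open>(q, v)\<close>. It does not refer to the acceleration: off the
  locus only \<open>S * DS(acc)\<close> matters, and this equals \<open>- P\<close>, a function of \<open>q\<close>. Positivity and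
  the lower bounds all follow from \<open>\<gamma> \<ge> G * M * K\<close>, where \<open>K\<close> is the least value of
  \<open>f' a b r / r\<close> over the pairs of bodies.
\<close>
lemma oscillator_coefficient_exists:
  assumes G: "G > 0"
    and f: "\<And>a b r. a \<noteq> b \<Longrightarrow> r > 0 \<Longrightarrow> (f a b has_real_derivative f' a b r) (at r)"
    and f'_pos: "\<And>a b r. a \<noteq> b \<Longrightarrow> r > 0 \<Longrightarrow> f' a b r > 0"
    and stiff: "\<And>a b r c. a \<noteq> b \<Longrightarrow> 0 < r \<Longrightarrow> r \<le> c \<Longrightarrow> f' a b c / c \<le> f' a b r / r"
    and J: "angular_momentum m q v = 0" and q: "collision_free q" and smooth: "smooth_near S q"
  shows "\<exists>\<gamma>>0.
    (\<forall>acc. newton_force m (two_body_potential G m f) q acc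
       \<longrightarrow> dir_deriv2 S q v + dir_deriv S q acc = - S q * \<gamma>) \<and>
    (\<forall>c \<delta>. (\<forall>a b. a \<noteq> b \<longrightarrow> dist (q $ a) (q $ b) \<le> c \<and> \<delta> \<le> f' a b c / c)
       \<longrightarrow> \<gamma> \<ge> G * total_mass m * \<delta>)"
proof -
  define k where "k a b = f' a b (dist (q $ a) (q $ b)) / dist (q $ a) (q $ b)" for a b
  define K where "K = Min ((\<lambda>(a, b). k a b) ` {(a, b). a \<noteq> b})"
  have ne: "(None, Some undefined) \<in> {(a :: 'd option, b). a \<noteq> b}" by simp
  have K_le: "K \<le> k a b" if "a \<noteq> b" for a b
    unfolding K_def using that by (intro Min_le) auto
  have "K \<in> (\<lambda>(a, b). k a b) ` {(a, b). a \<noteq> b}"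
    unfolding K_def using ne by (intro Min_in) auto
  then obtain a0 b0 where K_eq: "K = k a0 b0" and "a0 \<noteq> b0" by auto
  have dist_pos: "dist (q $ a) (q $ b) > 0" if "a \<noteq> b" for a b
    using q that unfolding collision_free_def by blast
  have K_pos: "K > 0"
    unfolding K_eq k_def using \<open>a0 \<noteq> b0\<close> by (intro divide_pos_pos f'_pos dist_pos)
  have K_ge: "\<delta> \<le> K" if "\<forall>a b. a \<noteq> b \<longrightarrow> dist (q $ a) (q $ b) \<le> c \<and> \<delta> \<le> f' a b c / c" for c \<delta>
  proof -
    have "\<delta> \<le> f' a0 b0 c / c" using that \<open>a0 \<noteq> b0\<close> by blast
    also have "\<dots> \<le> k a0 b0"
      unfolding k_def using that \<open>a0 \<noteq> b0\<close> by (intro stiff dist_pos) auto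
    finally show ?thesis by (simp add: K_eq)
  qed
  note S = smooth_near_has_derivative[OF smooth]
  obtain n where n: "norm n = 1" "moment q n = (S q)\<^sup>2" by (rule closest_normal)
  have nn: "n \<bullet> n = 1" using n(1) by (simp add: norm_eq_1)
  have work: "(\<Sum>a\<in>UNIV. m a * (w $ a \<bullet> acc $ a)) = - two_body_derivative G m f' q w"
    if "newton_force m (two_body_potential G m f) q acc" for acc w
    by (rule newton_force_dual[OF has_derivative_two_body_potential[OF f q] that])
  have "\<exists>\<gamma>\<ge>G * total_mass m * K.
    (\<forall>acc. newton_force m (two_body_potential G m f) q acc
       \<longrightarrow> dir_deriv2 S q v + dir_deriv S q acc = - S q * \<gamma>)"
  proof (cases "S q = 0")
    case True
    have n0: "moment q n = 0" using n(2) True by simp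
    then have "n \<bullet> centered q a = 0" for a unfolding moment_eq_0_iff by blast
    then have "n \<bullet> q $ a = n \<bullet> mass_center m q" for a
      by (metis centered_def inner_diff_right eq_iff_diff_eq_0)
    then have flat: "(q $ a - q $ b) \<bullet> n = 0" for a b
      by (simp add: inner_commute[of _ n] inner_diff_right)
    have "dir_deriv2 S q v + dir_deriv S q acc = 0"
      if acc: "newton_force m (two_body_potential G m f) q acc" for acc
    proof -
      have n_acc: "n \<bullet> acc $ a = 0" for a
      proof -
        have "(\<Sum>b\<in>UNIV. m b * (axis a n $ b \<bullet> acc $ b))
            = (\<Sum>b\<in>UNIV. if b = a then m a * (n \<bullet> acc $ a) else 0)"
          by (rule sum.cong) (simp_all add: axis_def)
        then have "m a * (n \<bullet> acc $ a) = (\<Sum>b\<in>UNIV. m b * (axis a n $ b \<bullet> acc $ b))" by simp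
        also have "\<dots> = - two_body_derivative G m f' q (axis a n)" by (rule work[OF acc])
        also have "\<dots> = 0"
        proof -
          have "(q $ b - q $ c) \<bullet> (axis a n $ b - axis a n $ c) = 0" for b c
            by (simp add: axis_def inner_diff_right flat)
          then show ?thesis by (simp add: two_body_derivative_def)
        qed
        finally show ?thesis using mass_pos[of a] by simp
      qed
      have "total_mass m * (n \<bullet> mass_center m acc) = 0"
        unfolding sum_mass_inner[symmetric] by (simp add: n_acc)
      then have "n \<bullet> centered acc a = 0" for a
        using total_mass_pos n_acc by (simp add: centered_def inner_diff_right)
      then have "dir_deriv S q acc = 0" by (rule derivative_in_locus_direction[OF S n(1) n0])
      then show ?thesis using S_second_derivative_on_locus[OF smooth J True] by simp
    qed
    then show ?thesis using True by (intro exI[of _ "G * total_mass m * K"]) simp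
  next
    case False
    \<comment> \<open>\<open>w\<close> is \<open>S\<close> times the gradient of \<open>S\<close> for the mass inner product.\<close>
    define w :: "'d configuration" where "w = (\<chi> a. (n \<bullet> centered q a) *\<^sub>R n)"
    define P where "P = two_body_derivative G m f' q w"
    have P: "P = G * ((\<Sum>(a, b) | a \<noteq> b. m a * m b * k a b * (n \<bullet> (q $ a - q $ b))\<^sup>2) / 2)"
    proof -
      have "w $ a - w $ b = (n \<bullet> (q $ a - q $ b)) *\<^sub>R n" for a b
        unfolding w_def by (simp add: centered_def inner_diff_right flip: scaleR_diff_left)
      then have "(q $ a - q $ b) \<bullet> (w $ a - w $ b) = (n \<bullet> (q $ a - q $ b))\<^sup>2" for a b
        by (simp add: inner_commute[of "q $ a - q $ b" n] power2_eq_square)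
      then show ?thesis unfolding P_def two_body_derivative_def k_def by simp
    qed
    have "G * total_mass m * K * (S q)\<^sup>2
        = G * ((\<Sum>(a, b) | a \<noteq> b. K * (m a * m b * (n \<bullet> (q $ a - q $ b))\<^sup>2)) / 2)"
      using pair_moment[of n q] by (simp add: case_prod_unfold n(2) flip: sum_distrib_left)
    also have "\<dots> \<le> P"
      unfolding P case_prod_unfold
    proof (intro mult_left_mono divide_right_mono sum_mono)
      fix p :: "'d option \<times> 'd option" assume "p \<in> {p. fst p \<noteq> snd p}"
      then have "K * (m (fst p) * m (snd p) * (n \<bullet> (q $ fst p - q $ snd p))\<^sup>2)
           \<le> k (fst p) (snd p) * (m (fst p) * m (snd p) * (n \<bullet> (q $ fst p - q $ snd p))\<^sup>2)"
        by (intro mult_right_mono K_le mult_nonneg_nonneg less_imp_le[OF mass_pos]) auto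
      then show "K * (m (fst p) * m (snd p) * (n \<bullet> (q $ fst p - q $ snd p))\<^sup>2)
           \<le> m (fst p) * m (snd p) * k (fst p) (snd p) * (n \<bullet> (q $ fst p - q $ snd p))\<^sup>2"
        by (simp add: mult_ac)
    qed (use G in auto)
    finally have P_ge: "G * total_mass m * K * (S q)\<^sup>2 \<le> P" .
    define \<gamma> where "\<gamma> = (P - S q * dir_deriv2 S q v) / (S q)\<^sup>2"
    have "G * total_mass m * K * (S q)\<^sup>2 \<le> P - S q * dir_deriv2 S q v"
      using P_ge S_second_derivative_sign[OF smooth J False] by simp
    then have "G * total_mass m * K \<le> \<gamma>"
      unfolding \<gamma>_def using False by (simp add: pos_le_divide_eq)
    moreover have "dir_deriv2 S q v + dir_deriv S q acc = - S q * \<gamma>"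
      if acc: "newton_force m (two_body_potential G m f) q acc" for acc
    proof -
      have "S q * dir_deriv S q acc = (\<Sum>a\<in>UNIV. m a * (w $ a \<bullet> acc $ a))"
        unfolding S_times_derivative[OF n S] by (simp add: w_def mult.assoc)
      also have "\<dots> = - P" unfolding work[OF acc] P_def ..
      finally have "S q * (dir_deriv2 S q v + dir_deriv S q acc) = S q * (- S q * \<gamma>)"
        using False by (simp add: \<gamma>_def power2_eq_square field_simps)
      then show ?thesis by (rule mult_left_cancel[OF False, THEN iffD1])
    qed
    ultimately show ?thesis by blast
  qed
  then obtain \<gamma> where \<gamma>: "G * total_mass m * K \<le> \<gamma>"
    "\<And>acc. newton_force m (two_body_potential G m f) q acc
       \<Longrightarrow> dir_deriv2 S q v + dir_deriv S q acc = - S q * \<gamma>"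
    by blast
  have GM: "G * total_mass m > 0" using G total_mass_pos by simp
  show ?thesis
  proof (intro exI[of _ \<gamma>] conjI allI impI)
    show "0 < \<gamma>" using \<gamma>(1) mult_pos_pos[OF GM K_pos] by simp
    fix c \<delta> assume "\<forall>a b. a \<noteq> b \<longrightarrow> dist (q $ a) (q $ b) \<le> c \<and> \<delta> \<le> f' a b c / c"
    then have "G * total_mass m * \<delta> \<le> G * total_mass m * K"
      using GM by (intro mult_left_mono K_ge) auto
    then show "G * total_mass m * \<delta> \<le> \<gamma>" using \<gamma>(1) by simp
  qed (use \<gamma>(2) in blast)
qed

text \<open>
  The function \<open>g\<close> is obtained by choosing a coefficient at each pair \<open>(q, v)\<close> separately. The bound
  is stated for any common lower bound \<open>\<delta>\<close> of \<open>f' a b c / c\<close> so that it specializes to both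
  classes of potentials.
\<close>
lemma signed_distance_oscillates:
  assumes G: "G > 0"
    and f: "\<And>a b r. a \<noteq> b \<Longrightarrow> r > 0 \<Longrightarrow> (f a b has_real_derivative f' a b r) (at r)"
    and f'_pos: "\<And>a b r. a \<noteq> b \<Longrightarrow> r > 0 \<Longrightarrow> f' a b r > 0"
    and stiff: "\<And>a b r c. a \<noteq> b \<Longrightarrow> 0 < r \<Longrightarrow> r \<le> c \<Longrightarrow> f' a b c / c \<le> f' a b r / r"
  obtains g :: "'d configuration \<Rightarrow> 'd configuration \<Rightarrow> real" where
    "\<And>q v. angular_momentum m q v = 0 \<Longrightarrow> collision_free q \<Longrightarrow> smooth_near S q \<Longrightarrow> g q v > 0"
    "\<And>I q v. newton_solution m (two_body_potential G m f) I q v \<Longrightarrow>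
       \<forall>t\<in>I. angular_momentum m (q t) (v t) = 0 \<Longrightarrow> \<forall>t\<in>I. smooth_near S (q t) \<Longrightarrow>
       \<exists>S'. \<forall>t\<in>I. ((\<lambda>s. S (q s)) has_real_derivative S' t) (at t) \<and>
              (S' has_real_derivative - S (q t) * g (q t) (v t)) (at t)"
    "\<And>q v c \<delta>. angular_momentum m q v = 0 \<Longrightarrow> collision_free q \<Longrightarrow> smooth_near S q \<Longrightarrow>
       \<forall>a b. a \<noteq> b \<longrightarrow> dist (q $ a) (q $ b) \<le> c \<and> \<delta> \<le> f' a b c / c \<Longrightarrow>
       g q v \<ge> G * total_mass m * \<delta>"
proof -
  let ?force = "newton_force m (two_body_potential G m f)"
  define admissible where "admissible q v \<longleftrightarrow>
    angular_momentum m q v = 0 \<and> collision_free q \<and> smooth_near S q" for q v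
  define coefficient where "coefficient q v \<gamma> \<longleftrightarrow> \<gamma> > 0 \<and>
      (\<forall>acc. ?force q acc \<longrightarrow> dir_deriv2 S q v + dir_deriv S q acc = - S q * \<gamma>) \<and>
      (\<forall>c \<delta>. (\<forall>a b. a \<noteq> b \<longrightarrow> dist (q $ a) (q $ b) \<le> c \<and> \<delta> \<le> f' a b c / c)
         \<longrightarrow> \<gamma> \<ge> G * total_mass m * \<delta>)" for q v \<gamma>
  have "\<exists>\<gamma>. coefficient q v \<gamma>" if "admissible q v" for q v
    using that unfolding coefficient_def admissible_def
    by (intro oscillator_coefficient_exists G f f'_pos stiff) auto
  then obtain g where coefficient: "\<And>q v. admissible q v \<Longrightarrow> coefficient q v (g q v)"
    by metis
  have g_pos: "g q v > 0" if "admissible q v" for q v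
    using coefficient[OF that] unfolding coefficient_def by (elim conjE)
  have g_ode: "dir_deriv2 S q v + dir_deriv S q acc = - S q * g q v"
    if "admissible q v" "?force q acc" for q v acc
  proof -
    have "\<forall>acc. ?force q acc \<longrightarrow> dir_deriv2 S q v + dir_deriv S q acc = - S q * g q v"
      using coefficient[OF that(1)] unfolding coefficient_def by (elim conjE)
    with that(2) show ?thesis by blast
  qed
  have g_bound: "g q v \<ge> G * total_mass m * \<delta>"
    if "admissible q v" "\<forall>a b. a \<noteq> b \<longrightarrow> dist (q $ a) (q $ b) \<le> c \<and> \<delta> \<le> f' a b c / c"
    for q v c \<delta>
  proof -
    have "\<forall>c \<delta>. (\<forall>a b. a \<noteq> b \<longrightarrow> dist (q $ a) (q $ b) \<le> c \<and> \<delta> \<le> f' a b c / c)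
         \<longrightarrow> g q v \<ge> G * total_mass m * \<delta>"
      using coefficient[OF that(1)] unfolding coefficient_def by (elim conjE)
    from this[rule_format, OF that(2)[rule_format]] show ?thesis .
  qed
  show ?thesis
  proof (rule that)
    fix I q v
    assume sol: "newton_solution m (two_body_potential G m f) I q v"
      and J: "\<forall>t\<in>I. angular_momentum m (q t) (v t) = 0"
      and smooth: "\<forall>t\<in>I. smooth_near S (q t)"
    obtain acc where I: "open I" and acc: "\<And>t. t \<in> I \<Longrightarrow> collision_free (q t)"
      "\<And>t. t \<in> I \<Longrightarrow> (q has_vector_derivative v t) (at t)"
      "\<And>t. t \<in> I \<Longrightarrow> (v has_vector_derivative acc t) (at t)"
      "\<And>t. t \<in> I \<Longrightarrow> ?force (q t) (acc t)"
      using sol unfolding newton_solution_def newton_force_def by blast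
    show "\<exists>S'. \<forall>t\<in>I. ((\<lambda>s. S (q s)) has_real_derivative S' t) (at t) \<and>
              (S' has_real_derivative - S (q t) * g (q t) (v t)) (at t)"
    proof (intro exI[of _ "\<lambda>t. dir_deriv S (q t) (v t)"] ballI conjI)
      fix t assume t: "t \<in> I"
      have ev: "\<forall>\<^sub>F s in nhds t. (q has_vector_derivative v s) (at s)"
        using eventually_nhds_in_open[OF I t] by eventually_elim (rule acc(2))
      note curve = smooth_near_along_curve[OF bspec[OF smooth t] ev acc(3)[OF t]]
      show "((\<lambda>s. S (q s)) has_real_derivative dir_deriv S (q t) (v t)) (at t)"
        using curve(1) by (rule eventually_nhds_x_imp_x)
      have "admissible (q t) (v t)" unfolding admissible_def using J smooth acc(1) t by blast
      from curve(2)[unfolded g_ode[OF this acc(4)[OF t]]]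
      show "((\<lambda>t. dir_deriv S (q t) (v t)) has_real_derivative - S (q t) * g (q t) (v t)) (at t)" .
    qed
  next
    fix q v assume "angular_momentum m q v = 0" "collision_free q" "smooth_near S q"
    then have "admissible q v" unfolding admissible_def by (intro conjI)
    then show "g q v > 0" by (rule g_pos)
    fix c \<delta> assume "\<forall>a b. a \<noteq> b \<longrightarrow> dist (q $ a) (q $ b) \<le> c \<and> \<delta> \<le> f' a b c / c"
    with \<open>admissible q v\<close> show "g q v \<ge> G * total_mass m * \<delta>" by (rule g_bound)
  qed
qed

end

lemma newtonian_potential_two_body:
  "newtonian_potential G m = two_body_potential G m (\<lambda>a b r. - 1 / r)"
  by (rule ext) (simp add: newtonian_potential_def two_body_potential_def sum_negf case_prod_unfold)

text \<open>
  As \<open>h'\<close> is positive and decreasing, so is \<open>h'(r) / r\<close>.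
\<close>
lemma admissible_profile_stiffness:
  assumes h: "admissible_profile h" and r: "0 < r" "r \<le> c"
  shows "deriv h c / c \<le> deriv h r / r"
proof (rule frac_le)
  have "\<And>x. r \<le> x \<Longrightarrow> x \<le> c \<Longrightarrow> \<exists>y. (deriv h has_real_derivative y) (at x) \<and> y \<le> 0"
    using h r(1) unfolding admissible_profile_def
    by (meson DERIV_deriv_iff_field_differentiable less_imp_le order_less_le_trans)
  then show "deriv h c \<le> deriv h r" by (rule DERIV_nonpos_imp_nonincreasing[OF r(2)])
  show "0 \<le> deriv h r" using h r(1) unfolding admissible_profile_def by (simp add: less_imp_le)
qed (use r in auto)

theorem proposition1p1:
  fixes m :: "'d::finite option \<Rightarrow> real" and G :: real
  assumes masses: "\<And>a. m a > 0" and G: "G > 0"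
  shows
    "(\<exists>g :: 'd configuration \<Rightarrow> 'd configuration \<Rightarrow> real.
        (\<forall>q v. angular_momentum m q v = 0 \<and> collision_free q \<and> smooth_near (signed_distance m) q
           \<longrightarrow> g q v > 0) \<and>
        (\<forall>I q v. newton_solution m (newtonian_potential G m) I q v \<and>
           (\<forall>t\<in>I. angular_momentum m (q t) (v t) = 0) \<and>
           (\<forall>t\<in>I. smooth_near (signed_distance m) (q t)) \<longrightarrow>
           (\<exists>S'. \<forall>t\<in>I.
              ((\<lambda>s. signed_distance m (q s)) has_real_derivative S' t) (at t) \<and>
              (S' has_real_derivative - signed_distance m (q t) * g (q t) (v t)) (at t)) \<and>
           (\<forall>c>0. (\<forall>t\<in>I. \<forall>a b. a \<noteq> b \<longrightarrow> dist (q t $ a) (q t $ b) \<le> c) \<longrightarrow>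
              (\<forall>t\<in>I. g (q t) (v t) \<ge> G * total_mass m / c ^ 3))))
     \<and>
     (\<forall>f. admissible_family f \<longrightarrow>
      (\<exists>g :: 'd configuration \<Rightarrow> 'd configuration \<Rightarrow> real.
        (\<forall>q v. angular_momentum m q v = 0 \<and> collision_free q \<and> smooth_near (signed_distance m) q
           \<longrightarrow> g q v > 0) \<and>
        (\<forall>I q v. newton_solution m (two_body_potential G m f) I q v \<and>
           (\<forall>t\<in>I. angular_momentum m (q t) (v t) = 0) \<and>
           (\<forall>t\<in>I. smooth_near (signed_distance m) (q t)) \<longrightarrow>
           (\<exists>S'. \<forall>t\<in>I.
              ((\<lambda>s. signed_distance m (q s)) has_real_derivative S' t) (at t) \<and>
              (S' has_real_derivative - signed_distance m (q t) * g (q t) (v t)) (at t)) \<and>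
           (\<forall>c>0. (\<forall>t\<in>I. \<forall>a b. a \<noteq> b \<longrightarrow> dist (q t $ a) (q t $ b) \<le> c) \<longrightarrow>
              (\<forall>t\<in>I. g (q t) (v t) \<ge>
                 G * total_mass m * Min {deriv (f a b) c / c | a b. a \<noteq> b})))))"
proof -
  interpret masses m using masses by unfold_locales
  have collision_free_solution: "collision_free (q t)"
    if "newton_solution m V I q v" "t \<in> I" for V I t and q v :: "real \<Rightarrow> 'd configuration"
    using that unfolding newton_solution_def by blast
  show ?thesis
  proof (rule conjI, goal_cases)
    case 1
    obtain g where g:
      "\<And>q v. angular_momentum m q v = 0 \<Longrightarrow> collision_free q \<Longrightarrow> smooth_near S q \<Longrightarrow> g q v > 0"
      "\<And>I q v. newton_solution m (two_body_potential G m (\<lambda>a b r. - 1 / r)) I q v \<Longrightarrow>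
         \<forall>t\<in>I. angular_momentum m (q t) (v t) = 0 \<Longrightarrow> \<forall>t\<in>I. smooth_near S (q t) \<Longrightarrow>
         \<exists>S'. \<forall>t\<in>I. ((\<lambda>s. S (q s)) has_real_derivative S' t) (at t) \<and>
                (S' has_real_derivative - S (q t) * g (q t) (v t)) (at t)"
      "\<And>q v c \<delta>. angular_momentum m q v = 0 \<Longrightarrow> collision_free q \<Longrightarrow> smooth_near S q \<Longrightarrow>
         \<forall>a b. a \<noteq> b \<longrightarrow> dist (q $ a) (q $ b) \<le> c \<and> \<delta> \<le> 1 / c\<^sup>2 / c \<Longrightarrow>
         g q v \<ge> G * total_mass m * \<delta>"
    proof (rule signed_distance_oscillates[OF G, of "\<lambda>a b r. - 1 / r" "\<lambda>a b r. 1 / r\<^sup>2"])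
      fix r :: real assume "r > 0"
      then show "((\<lambda>r. - 1 / r) has_real_derivative 1 / r\<^sup>2) (at r)"
        by (auto intro!: derivative_eq_intros simp: power2_eq_square)
      show "0 < 1 / r\<^sup>2" using \<open>r > 0\<close> by simp
      fix c assume "r \<le> c"
      then show "1 / c\<^sup>2 / c \<le> 1 / r\<^sup>2 / r"
        using \<open>r > 0\<close> by (intro frac_le power_mono) auto
    qed blast
    show ?case
    proof (intro exI[of _ g] conjI allI impI ballI; (elim conjE)?)
      fix I q v c t
      assume sol: "newton_solution m (newtonian_potential G m) I q v" "t \<in> I"
        "\<forall>t\<in>I. angular_momentum m (q t) (v t) = 0" "\<forall>t\<in>I. smooth_near S (q t)"
        "\<forall>t\<in>I. \<forall>a b. a \<noteq> b \<longrightarrow> dist (q t $ a) (q t $ b) \<le> c"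
      have "G * total_mass m * (1 / c\<^sup>2 / c) \<le> g (q t) (v t)"
        using sol collision_free_solution[OF sol(1,2)] by (intro g(3)[where c = c]) auto
      then show "G * total_mass m / c ^ 3 \<le> g (q t) (v t)"
        by (simp add: power2_eq_square power3_eq_cube)
    qed (use g(1,2) in \<open>simp_all add: newtonian_potential_two_body\<close>)
  next
    case 2
    show ?case
    proof (intro allI impI, goal_cases)
      case (1 f)
      then have f: "admissible_profile (f a b)" if "a \<noteq> b" for a b
        using that unfolding admissible_family_def by blast
      obtain g where g:
        "\<And>q v. angular_momentum m q v = 0 \<Longrightarrow> collision_free q \<Longrightarrow> smooth_near S q \<Longrightarrow> g q v > 0"
        "\<And>I q v. newton_solution m (two_body_potential G m f) I q v \<Longrightarrow>
           \<forall>t\<in>I. angular_momentum m (q t) (v t) = 0 \<Longrightarrow> \<forall>t\<in>I. smooth_near S (q t) \<Longrightarrow>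
           \<exists>S'. \<forall>t\<in>I. ((\<lambda>s. S (q s)) has_real_derivative S' t) (at t) \<and>
                  (S' has_real_derivative - S (q t) * g (q t) (v t)) (at t)"
        "\<And>q v c \<delta>. angular_momentum m q v = 0 \<Longrightarrow> collision_free q \<Longrightarrow> smooth_near S q \<Longrightarrow>
           \<forall>a b. a \<noteq> b \<longrightarrow> dist (q $ a) (q $ b) \<le> c \<and> \<delta> \<le> deriv (f a b) c / c \<Longrightarrow>
           g q v \<ge> G * total_mass m * \<delta>"
      proof (rule signed_distance_oscillates[OF G, of f "\<lambda>a b. deriv (f a b)"])
        fix a b :: "'d option" and r :: real assume ab: "a \<noteq> b" and r: "r > 0"
        show "(f a b has_real_derivative deriv (f a b) r) (at r)" "0 < deriv (f a b) r"
          using f[OF ab] r unfolding admissible_profile_def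
          by (auto simp: DERIV_deriv_iff_field_differentiable)
        fix c assume "r \<le> c"
        then show "deriv (f a b) c / c \<le> deriv (f a b) r / r"
          by (rule admissible_profile_stiffness[OF f[OF ab] r])
      qed blast
      have Min_le_pair: "Min {deriv (f a b) c / c | a b. a \<noteq> b} \<le> deriv (f a b) c / c"
        if "a \<noteq> b" for a b c
      proof (rule Min_le)
        have "{deriv (f a b) c / c | a b. a \<noteq> b} \<subseteq> (\<lambda>(a, b). deriv (f a b) c / c) ` UNIV" by auto
        then show "finite {deriv (f a b) c / c | a b. a \<noteq> b}" by (rule finite_subset) simp
      qed (use that in blast)
      show ?case
      proof (intro exI[of _ g] conjI allI impI ballI; (elim conjE)?)
        fix I q v c t
        assume sol: "newton_solution m (two_body_potential G m f) I q v" "t \<in> I"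
          "\<forall>t\<in>I. angular_momentum m (q t) (v t) = 0" "\<forall>t\<in>I. smooth_near S (q t)"
          "\<forall>t\<in>I. \<forall>a b. a \<noteq> b \<longrightarrow> dist (q t $ a) (q t $ b) \<le> c"
        show "G * total_mass m * Min {deriv (f a b) c / c | a b. a \<noteq> b} \<le> g (q t) (v t)"
          using sol collision_free_solution[OF sol(1,2)] Min_le_pair
          by (intro g(3)[where c = c]) auto
      qed (use g(1,2) in simp_all)
    qed
  qed
qed

end
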